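(* Let $\Gamma$ and $\Delta$ be multisets of normalized formulas not containing the literal $p$, let $T_1,\dots,T_n,Z$ be simple products not containing $p$, and let $K$ be the multiset $T_1,\dots,T_n$; write $F_K$ for the multiset $F_{T_1},\dots,F_{T_n}$. (a) If the sequent $E_{W'},F_K,F_\Delta,!F_\Gamma\vdash E_{p\otimes Z}$ is derivable in Linear Logic (for a simple product $W'$), then (1) $W'$ contains exactly one occurrence of $p$ and $W'\cong p\otimes W$; and (2) one can construct a one-stack acyclic program $P$ that is a strong solution to the sequent $W,T_1,\dots,T_n,\Delta,!\Gamma\vdash Z$. (b) If the sequent $E_{W'},F_K,F_\Delta,!F_\Gamma\vdash E_p$ is derivable in Linear Logic, then (1) $W'=p$; and (2) both $K$ and $\Delta$ are empty and $!F_\Gamma$ is degenerate: it is produced by the rules W$!$ and C$!$ only (there is no application of the rule L$!$ in the derivation above this sequent).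
   Context: Derivability is in the standard two-sided cut-free sequent calculus of propositional Linear Logic (L$!$ dereliction, W$!$, C$!$ weakening and contraction of $!$-formulas). Fix an integer $N$; all literals are among $p_1,\dots,p_{N-7}$, one of which is the distinguished literal $p$. A simple product is a tensor product of $\ge1$ literals, identified with a multiset; $X\cong Y$ means equal multisets. Normalized formulas: Horn $X\multimap Y$, $\oplus$-Horn $X\multimap(Y_1\oplus Y_2)$, $\&$-Horn $(X_1\multimap Y_1)\&(X_2\multimap Y_2)$, elementary embedded $(U\multimap V)\multimap Y$, all letters simple products. $A^{(n)}=A\otimes\cdots\otimes A$ ($n$ times), $A^{(0)}=\mathbf{1}$. $H_{00}=\bot^{(N+2)}\multimap\bot^{(2)}$, $C_{00}=(H_{00}^{(2)}\multimap\bot^{(3)})\multimap\bot^{(3)}$, $H_1=C_{00}^{(4)}\multimap\bot^{(N)}$, $D_{p_m}=(H_1\multimap\bot^{(m+4)})\multimap\bot^{(m+4)}$, $D_{q_1\otimes\cdots\otimes q_n}=D_{q_1}\otimes\cdots\otimes D_{q_n}$, $E_X=C_{00}^{(6)}\otimes D_X$; $F_{X\multimap Y}=E_{p\otimes X}\multimap E_{p\otimes Y}$, $F_Y=E_p\multimap E_{p\otimes Y}$ (for a simple product $Y$), $F_{(U\multimap V)\multimap Y}=F_{U\multimap V}\multimap F_Y$, $F_{X\multimap(Y_1\oplus Y_2)}=E_{p\otimes X}\multimap(E_{p\otimes Y_1}\oplus E_{p\otimes Y_2})$, $F_{(X_1\multimap Y_1)\&(X_2\multimap Y_2)}=F_{X_1\multimap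 Y_1}\&F_{X_2\multimap Y_2}$; $F_\Delta$, $!F_\Gamma$ elementwise. A one-stack acyclic program is a finite rooted binary tree (root = input vertex, leaves = output vertices) with edges labelled by Horn implications $X\multimap Y$, push commands $PUSH(Y_1;X_2,Y_2)$ or pop commands $POP(V)$; a divergent vertex (two outgoing edges) has its edges labelled $X\multimap Y_1$, $X\multimap Y_2$ with common antecedent; on every root-to-leaf path pushes and pops are well-bracketed (each push has a unique pop-partner on that path). Strong computation on input $W$: root gets $OUT=W$ and empty stack; across $X\multimap Y$, if $OUT(v)\cong X\otimes V$ ($V$ a possibly empty product) then $OUT(w)=Y\otimes V$, stack unchanged; across $PUSH(Y_1;X_2,Y_2)$, if $OUT(v)\cong X_1\otimes X_2$ ($X_1$ possibly empty) then $X_1\otimes Y_1$ is pushed and $OUT(w)=X_2\otimes Y_2$; across $POP(V)$, if $OUT(v)\cong V$ then the top $Y$ is popped and $OUT(w)=Y$; otherwise $OUT(w)$ is undefined. $P(W)=Z$ means every output vertex has $OUT$ defined and equal to $Z$ and empty stack. Formulas used on an edge: on a Horn edge $A$ out of a non-divergent vertex, $A$, $A\&B$ or $B\&A$ ($B$ any Horn implication); on each edge out of a divergent vertex labelled $X\multimap Y_1$, $X\multimap Y_2$, the formula $X\multimap(Y_1\oplus Y_2)$; on a push edge $PUSH(Y_1;X_2,Y_2)$ all of whose pop-partners are labelled $POP(V)$, the formula $(Y_2\multimap V)\multimap Y_1$. $P$ is a strong solution to $W_0,\dots,W_n,\Delta,!\Gamma\vdash Z$ ($W_i$ simple products) if $P(W_0\otimes\cdots\otimes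 W_n)=Z$, the formula used on each non-pop edge is drawn from $\Gamma$ or $\Delta$, and on every root-to-leaf path each formula of $\Delta$ is used exactly once.
   Formalization: In a push command PUSH(Y_1;X_2,Y_2) the product X_2, like X_1, may be empty, and W in W' ≅ p⊗W may be empty (W' = p); if X_2 or W had to be non-empty, part (a) would fail. *)

theory Defs
  imports "HOL-Library.Multiset"
begin

section \<open>Propositional linear logic\<close>

datatype ll =
    Atom nat
  | Neg ll
  | MOne ("\<one>")
  | MBot ("\<bottom>")
  | ATop
  | AZero
  | Tensor ll ll (infixr "\<otimes>" 75)
  | Par ll ll
  | Limp ll ll (infixr "\<multimap>" 65)
  | With ll ll
  | Plus ll ll (infixr "\<oplus>" 70)
  | OfCourse ll
  | WhyNot ll

text \<open>
  Two-sided cut-free sequent calculus.  Sequents are pairs of multisets, so exchange is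
  implicit.  \<open>LL k \<Gamma> \<Delta>\<close> means that \<open>\<Gamma> \<turnstile> \<Delta>\<close> has a derivation tree with exactly \<open>k\<close>
  applications of the dereliction rule \<open>L!\<close> (rule \<open>bang_L\<close>).
\<close>

inductive LL :: "nat \<Rightarrow> ll multiset \<Rightarrow> ll multiset \<Rightarrow> bool" where
  ax: "LL 0 {#A#} {#A#}"
| neg_L: "LL k \<Gamma> (add_mset A \<Delta>) \<Longrightarrow> LL k (add_mset (Neg A) \<Gamma>) \<Delta>"
| neg_R: "LL k (add_mset A \<Gamma>) \<Delta> \<Longrightarrow> LL k \<Gamma> (add_mset (Neg A) \<Delta>)"
| one_L: "LL k \<Gamma> \<Delta> \<Longrightarrow> LL k (add_mset \<one> \<Gamma>) \<Delta>"
| one_R: "LL 0 {#} {#\<one>#}"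
| bot_L: "LL 0 {#\<bottom>#} {#}"
| bot_R: "LL k \<Gamma> \<Delta> \<Longrightarrow> LL k \<Gamma> (add_mset \<bottom> \<Delta>)"
| top_R: "LL 0 \<Gamma> (add_mset ATop \<Delta>)"
| zero_L: "LL 0 (add_mset AZero \<Gamma>) \<Delta>"
| tensor_L: "LL k (add_mset A (add_mset B \<Gamma>)) \<Delta> \<Longrightarrow> LL k (add_mset (A \<otimes> B) \<Gamma>) \<Delta>"
| tensor_R: "\<lbrakk>LL k1 \<Gamma>1 (add_mset A \<Delta>1); LL k2 \<Gamma>2 (add_mset B \<Delta>2)\<rbrakk>
    \<Longrightarrow> LL (k1 + k2) (\<Gamma>1 + \<Gamma>2) (add_mset (A \<otimes> B) (\<Delta>1 + \<Delta>2))"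
| par_L: "\<lbrakk>LL k1 (add_mset A \<Gamma>1) \<Delta>1; LL k2 (add_mset B \<Gamma>2) \<Delta>2\<rbrakk>
    \<Longrightarrow> LL (k1 + k2) (add_mset (Par A B) (\<Gamma>1 + \<Gamma>2)) (\<Delta>1 + \<Delta>2)"
| par_R: "LL k \<Gamma> (add_mset A (add_mset B \<Delta>)) \<Longrightarrow> LL k \<Gamma> (add_mset (Par A B) \<Delta>)"
| limp_L: "\<lbrakk>LL k1 \<Gamma>1 (add_mset A \<Delta>1); LL k2 (add_mset B \<Gamma>2) \<Delta>2\<rbrakk>
    \<Longrightarrow> LL (k1 + k2) (add_mset (A \<multimap> B) (\<Gamma>1 + \<Gamma>2)) (\<Delta>1 + \<Delta>2)"
| limp_R: "LL k (add_mset A \<Gamma>) (add_mset B \<Delta>) \<Longrightarrow> LL k \<Gamma> (add_mset (A \<multimap> B) \<Delta>)"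
| with_L1: "LL k (add_mset A \<Gamma>) \<Delta> \<Longrightarrow> LL k (add_mset (With A B) \<Gamma>) \<Delta>"
| with_L2: "LL k (add_mset B \<Gamma>) \<Delta> \<Longrightarrow> LL k (add_mset (With A B) \<Gamma>) \<Delta>"
| with_R: "\<lbrakk>LL k1 \<Gamma> (add_mset A \<Delta>); LL k2 \<Gamma> (add_mset B \<Delta>)\<rbrakk>
    \<Longrightarrow> LL (k1 + k2) \<Gamma> (add_mset (With A B) \<Delta>)"
| plus_L: "\<lbrakk>LL k1 (add_mset A \<Gamma>) \<Delta>; LL k2 (add_mset B \<Gamma>) \<Delta>\<rbrakk>
    \<Longrightarrow> LL (k1 + k2) (add_mset (A \<oplus> B) \<Gamma>) \<Delta>"
| plus_R1: "LL k \<Gamma> (add_mset A \<Delta>) \<Longrightarrow> LL k \<Gamma> (add_mset (A \<oplus> B) \<Delta>)"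
| plus_R2: "LL k \<Gamma> (add_mset B \<Delta>) \<Longrightarrow> LL k \<Gamma> (add_mset (A \<oplus> B) \<Delta>)"
| bang_L: "LL k (add_mset A \<Gamma>) \<Delta> \<Longrightarrow> LL (Suc k) (add_mset (OfCourse A) \<Gamma>) \<Delta>"
| bang_W: "LL k \<Gamma> \<Delta> \<Longrightarrow> LL k (add_mset (OfCourse A) \<Gamma>) \<Delta>"
| bang_C: "LL k (add_mset (OfCourse A) (add_mset (OfCourse A) \<Gamma>)) \<Delta>
    \<Longrightarrow> LL k (add_mset (OfCourse A) \<Gamma>) \<Delta>"
| bang_R: "LL k (image_mset OfCourse \<Gamma>) (add_mset A (image_mset WhyNot \<Delta>))
    \<Longrightarrow> LL k (image_mset OfCourse \<Gamma>) (add_mset (OfCourse A) (image_mset WhyNot \<Delta>))"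
| quest_R: "LL k \<Gamma> (add_mset A \<Delta>) \<Longrightarrow> LL k \<Gamma> (add_mset (WhyNot A) \<Delta>)"
| quest_W: "LL k \<Gamma> \<Delta> \<Longrightarrow> LL k \<Gamma> (add_mset (WhyNot A) \<Delta>)"
| quest_C: "LL k \<Gamma> (add_mset (WhyNot A) (add_mset (WhyNot A) \<Delta>))
    \<Longrightarrow> LL k \<Gamma> (add_mset (WhyNot A) \<Delta>)"
| quest_L: "LL k (add_mset A (image_mset OfCourse \<Gamma>)) (image_mset WhyNot \<Delta>)
    \<Longrightarrow> LL k (add_mset (WhyNot A) (image_mset OfCourse \<Gamma>)) (image_mset WhyNot \<Delta>)"

definition derivable :: "ll multiset \<Rightarrow> ll multiset \<Rightarrow> bool" where
  "derivable \<Gamma> \<Delta> \<longleftrightarrow> (\<exists>k. LL k \<Gamma> \<Delta>)"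

fun tensor_list :: "ll list \<Rightarrow> ll" where
  "tensor_list [] = \<one>"
| "tensor_list [A] = A"
| "tensor_list (A # As) = A \<otimes> tensor_list As"

definition tensor_power :: "ll \<Rightarrow> nat \<Rightarrow> ll" where
  "tensor_power A n = tensor_list (replicate n A)"


section \<open>Simple products and normalized formulas\<close>

text \<open>
  The literal \<open>p\<^sub>m\<close> is represented by its index \<open>m \<in> {1..N-7}\<close>.  A written tensor product of
  literals is a list; the simple product it denotes is the multiset of that list.
  Normalized formulas are therefore parametrized by the type of their products:
  \<open>nat list nform\<close> is the type of written formulas (these are the ones that are translated
  into linear logic), \<open>nat multiset nform\<close> the type of formulas up to \<open>\<cong>\<close> (these are the ones
  that are executed by programs), and \<open>map_nform mset\<close> passes from the former to the latter.
\<close>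

type_synonym product = "nat multiset"

definition simple_product :: "nat \<Rightarrow> product \<Rightarrow> bool" where
  "simple_product N X \<longleftrightarrow> X \<noteq> {#} \<and> set_mset X \<subseteq> {1..N - 7}"

text \<open>
  \<open>Horn X Y\<close> is \<open>X \<multimap> Y\<close>; \<open>PlusHorn X Y1 Y2\<close> is \<open>X \<multimap> (Y1 \<oplus> Y2)\<close>;
  \<open>WithHorn X1 Y1 X2 Y2\<close> is \<open>(X1 \<multimap> Y1) & (X2 \<multimap> Y2)\<close>; \<open>Embedded U V Y\<close> is \<open>(U \<multimap> V) \<multimap> Y\<close>.
\<close>

datatype (products: 'x) nform =
    Horn 'x 'x
  | PlusHorn 'x 'x 'x
  | WithHorn 'x 'x 'x 'x
  | Embedded 'x 'x 'x
for map: map_nform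

definition normalized_without :: "nat \<Rightarrow> nat \<Rightarrow> nat list nform \<Rightarrow> bool" where
  "normalized_without N p A \<longleftrightarrow> (\<forall>X \<in> products A. simple_product N (mset X) \<and> p \<notin> set X)"


section \<open>The translation into the unit-only fragment\<close>

definition H00 :: "nat \<Rightarrow> ll" where
  "H00 N = tensor_power \<bottom> (N + 2) \<multimap> tensor_power \<bottom> 2"

definition C00 :: "nat \<Rightarrow> ll" where
  "C00 N = (tensor_power (H00 N) 2 \<multimap> tensor_power \<bottom> 3) \<multimap> tensor_power \<bottom> 3"

definition H1 :: "nat \<Rightarrow> ll" where
  "H1 N = tensor_power (C00 N) 4 \<multimap> tensor_power \<bottom> N"

definition D_lit :: "nat \<Rightarrow> nat \<Rightarrow> ll" where
  "D_lit N m = (H1 N \<multimap> tensor_power \<bottom> (m + 4)) \<multimap> tensor_power \<bottom> (m + 4)"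

definition D_prod :: "nat \<Rightarrow> nat list \<Rightarrow> ll" where
  "D_prod N X = tensor_list (map (D_lit N) X)"

definition E :: "nat \<Rightarrow> nat list \<Rightarrow> ll" where
  "E N X = tensor_power (C00 N) 6 \<otimes> D_prod N X"

definition F_prod :: "nat \<Rightarrow> nat \<Rightarrow> nat list \<Rightarrow> ll" where
  "F_prod N p Y = E N [p] \<multimap> E N (p # Y)"

definition F_horn :: "nat \<Rightarrow> nat \<Rightarrow> nat list \<Rightarrow> nat list \<Rightarrow> ll" where
  "F_horn N p X Y = E N (p # X) \<multimap> E N (p # Y)"

fun F :: "nat \<Rightarrow> nat \<Rightarrow> nat list nform \<Rightarrow> ll" where
  "F N p (Horn X Y) = F_horn N p X Y"
| "F N p (PlusHorn X Y1 Y2) = E N (p # X) \<multimap> (E N (p # Y1) \<oplus> E N (p # Y2))"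
| "F N p (WithHorn X1 Y1 X2 Y2) = With (F_horn N p X1 Y1) (F_horn N p X2 Y2)"
| "F N p (Embedded U V Y) = F_horn N p U V \<multimap> F_prod N p Y"


section \<open>One-stack acyclic programs\<close>

text \<open>
  A program is the subtree below a vertex.  \<open>Diverge X Y1 P1 Y2 P2\<close> is a divergent vertex with
  edges labelled \<open>X \<multimap> Y1\<close> (to the root of \<open>P1\<close>) and \<open>X \<multimap> Y2\<close> (to the root of \<open>P2\<close>).
\<close>

datatype label =
    HORN product product
  | PUSH product product product
  | POP product

datatype program =
    Output
  | Step label program
  | Diverge product product program product program

text \<open>The component \<open>X2\<close> of \<open>PUSH Y1 X2 Y2\<close> is allowed to be empty.\<close>

fun label_ok :: "nat \<Rightarrow> label \<Rightarrow> bool" where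
  "label_ok N (HORN X Y) \<longleftrightarrow> simple_product N X \<and> simple_product N Y"
| "label_ok N (PUSH Y1 X2 Y2) \<longleftrightarrow>
     simple_product N Y1 \<and> set_mset X2 \<subseteq> {1..N - 7} \<and> simple_product N Y2"
| "label_ok N (POP V) \<longleftrightarrow> simple_product N V"

fun labels_ok :: "nat \<Rightarrow> program \<Rightarrow> bool" where
  "labels_ok N Output \<longleftrightarrow> True"
| "labels_ok N (Step l P) \<longleftrightarrow> label_ok N l \<and> labels_ok N P"
| "labels_ok N (Diverge X Y1 P1 Y2 P2) \<longleftrightarrow>
     label_ok N (HORN X Y1) \<and> label_ok N (HORN X Y2) \<and> labels_ok N P1 \<and> labels_ok N P2"

text \<open>
  \<open>bracketed d P\<close>: on every path from the root of \<open>P\<close> to a leaf the pushes and pops are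
  well-bracketed, where \<open>d\<close> pushes above the root of \<open>P\<close> are still unmatched.
\<close>

fun bracketed :: "nat \<Rightarrow> program \<Rightarrow> bool" where
  "bracketed d Output \<longleftrightarrow> d = 0"
| "bracketed d (Step (HORN X Y) P) \<longleftrightarrow> bracketed d P"
| "bracketed d (Step (PUSH Y1 X2 Y2) P) \<longleftrightarrow> bracketed (Suc d) P"
| "bracketed d (Step (POP V) P) \<longleftrightarrow> d > 0 \<and> bracketed (d - 1) P"
| "bracketed d (Diverge X Y1 P1 Y2 P2) \<longleftrightarrow> bracketed d P1 \<and> bracketed d P2"

definition one_stack_acyclic :: "nat \<Rightarrow> program \<Rightarrow> bool" where
  "one_stack_acyclic N P \<longleftrightarrow> labels_ok N P \<and> bracketed 0 P"

text \<open>
  For the subtree \<open>P\<close> below a push edge, \<open>pop_partners 0 P\<close> collects the products \<open>V\<close> of the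
  edges \<open>POP(V)\<close> that are pop-partners of this push; the first argument counts the pushes
  inside \<open>P\<close> that are still unmatched.
\<close>

fun pop_partners :: "nat \<Rightarrow> program \<Rightarrow> product set" where
  "pop_partners d Output = {}"
| "pop_partners d (Step (HORN X Y) P) = pop_partners d P"
| "pop_partners d (Step (PUSH Y1 X2 Y2) P) = pop_partners (Suc d) P"
| "pop_partners d (Step (POP V) P) = (if d = 0 then {V} else pop_partners (d - 1) P)"
| "pop_partners d (Diverge X Y1 P1 Y2 P2) = pop_partners d P1 \<union> pop_partners d P2"


subsection \<open>Strong computation\<close>

text \<open>A state consists of the value of \<open>OUT\<close> and the stack; \<open>None\<close> means undefined.\<close>

type_synonym state = "product \<times> product list"

fun exec :: "label \<Rightarrow> state \<Rightarrow> state option" where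
  "exec (HORN X Y) (out, st) = (if X \<subseteq># out then Some (Y + (out - X), st) else None)"
| "exec (PUSH Y1 X2 Y2) (out, st) =
     (if X2 \<subseteq># out then Some (X2 + Y2, ((out - X2) + Y1) # st) else None)"
| "exec (POP V) (out, []) = None"
| "exec (POP V) (out, Y # st) = (if out = V then Some (Y, st) else None)"

text \<open>The states at the output vertices, given the state at the root.\<close>

fun outputs :: "program \<Rightarrow> state option \<Rightarrow> state option set" where
  "outputs Output s = {s}"
| "outputs (Step l P) s = outputs P (Option.bind s (exec l))"
| "outputs (Diverge X Y1 P1 Y2 P2) s =
     outputs P1 (Option.bind s (exec (HORN X Y1))) \<union>
     outputs P2 (Option.bind s (exec (HORN X Y2)))"

definition computes :: "program \<Rightarrow> product \<Rightarrow> product \<Rightarrow> bool" where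
  "computes P W Z \<longleftrightarrow> (\<forall>s \<in> outputs P (Some (W, [])). s = Some (Z, []))"


subsection \<open>Strong solutions\<close>

text \<open>
  \<open>uses l P\<close> is the set of formulas that may be used on an edge with label \<open>l\<close> that leaves a
  non-divergent vertex and leads to the root of \<open>P\<close>.
\<close>

fun uses :: "label \<Rightarrow> program \<Rightarrow> product nform set" where
  "uses (HORN X Y) P =
     {Horn X Y} \<union> {WithHorn X Y X' Y' | X' Y'. True} \<union> {WithHorn X' Y' X Y | X' Y'. True}"
| "uses (PUSH Y1 X2 Y2) P = {Embedded Y2 V Y1 | V. pop_partners 0 P = {V}}"
| "uses (POP V) P = {}"

text \<open>
  \<open>drawn \<Gamma> \<Delta> P\<close>: one can choose, for every non-pop edge of \<open>P\<close>, a formula used on it and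
  its source (\<open>\<Gamma>\<close> or \<open>\<Delta>\<close>), so that on every path from the root of \<open>P\<close> to a leaf the
  formulas drawn from the second source are exactly those of the multiset \<open>\<Delta>\<close>.  In the
  recursion, \<open>\<Delta>\<close> is what remains to be used below the current vertex.
\<close>

fun drawn :: "product nform multiset \<Rightarrow> product nform multiset \<Rightarrow> program \<Rightarrow> bool" where
  "drawn \<Gamma> \<Delta> Output \<longleftrightarrow> \<Delta> = {#}"
| "drawn \<Gamma> \<Delta> (Step (POP V) P) \<longleftrightarrow> drawn \<Gamma> \<Delta> P"
| "drawn \<Gamma> \<Delta> (Step l P) \<longleftrightarrow>
     (\<exists>A \<in> uses l P. A \<in># \<Gamma> \<and> drawn \<Gamma> \<Delta> P \<or> A \<in># \<Delta> \<and> drawn \<Gamma> (\<Delta> - {#A#}) P)"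
| "drawn \<Gamma> \<Delta> (Diverge X Y1 P1 Y2 P2) \<longleftrightarrow>
     (let A = PlusHorn X Y1 Y2 in
       (A \<in># \<Gamma> \<and> drawn \<Gamma> \<Delta> P1 \<or> A \<in># \<Delta> \<and> drawn \<Gamma> (\<Delta> - {#A#}) P1) \<and>
       (A \<in># \<Gamma> \<and> drawn \<Gamma> \<Delta> P2 \<or> A \<in># \<Delta> \<and> drawn \<Gamma> (\<Delta> - {#A#}) P2))"

text \<open>\<open>P\<close> is a strong solution to the sequent \<open>Ws, \<Delta>, !\<Gamma> \<turnstile> Z\<close>.\<close>

definition strong_solution ::
  "nat \<Rightarrow> program \<Rightarrow> product multiset \<Rightarrow> product nform multiset \<Rightarrow> product nform multiset
    \<Rightarrow> product \<Rightarrow> bool" where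
  "strong_solution N P Ws \<Delta> \<Gamma> Z \<longleftrightarrow>
     one_stack_acyclic N P \<and> computes P (\<Sum>\<^sub># Ws) Z \<and> drawn \<Gamma> \<Delta> P"

end

theory Submission
  imports Defs "HOL-Library.Set_Algebras" "HOL-Library.Product_Plus"
begin

text \<open>
  Derivable sequents hold in every classical phase space, that is, a commutative monoid with a
  subset (the pole) interpreting \<open>\<bottom>\<close>.  We choose a phase space in which \<open>D_lit N m\<close> behaves like
  the literal \<open>p\<^sub>m\<close> and in which membership in the pole of the point belonging to a sequent
  \<open>E_W, F_\<Delta> \<turnstile> E_Z\<close> means that a strong solution exists; soundness then yields the program, and no
  derivation has to be analysed.  The pole consists of points of charge \<open>1\<close> modulo \<open>9N\<close>, where
  \<open>\<bottom>\<close> has charge \<open>1\<close>, tensor adds and \<open>\<multimap>\<close> subtracts charges; so \<open>H00\<close>, \<open>C00\<close>, \<open>H1\<close>, \<open>D_lit N m\<close>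
  have charges \<open>-N\<close>, \<open>-2N\<close>, \<open>9N\<close>, \<open>9N\<close>.  Only a few kinds of points carry a further condition;
  a decomposition of a point that the encoding does not intend is excluded because some factor
  would have the wrong charge.
\<close>

section \<open>Phase semantics of linear logic\<close>

text \<open>The modulus \<open>9N\<close> is the charge of \<open>H1\<close>. Modulo
  \<open>9N\<close> the formula \<open>H1\<close>, every encoded literal and every \<open>F\<close>
  are neutral, so that \<open>E\<close> has charge \<open>-3N\<close> whatever its product and
  formulas can be used without any effect on charges.

  The obstacle is that interpretations contain far more points than the intended ones, and each
  implication has to be checked against all of them. This is met level by level, along
  \<open>\<bottom>\<close>, \<open>H00\<close>, \<open>C00\<close>, \<open>H1\<close>,
  \<open>D_lit\<close>: a generic element is shown to belong to the interpretation, and conversely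
  every member has the right charge and, over the sector of the generic element, carries only the
  intended resource. The converse at one level is what makes the next generic element work.
  Interpretations are thus never computed exactly below \<open>E\<close>; for \<open>E\<close> the
  orthogonal is determined explicitly, and the formulas \<open>F\<close> act on it as steps of
  programs.

  Part (b) lives in the same pole: it is the case of the empty goal, and the number of marks in a
  resource is constrained for that goal only.\<close>

locale phase_space =
  fixes pole :: "'m::comm_monoid_add set"
begin

definition orth :: "'m set \<Rightarrow> 'm set" where
  "orth X = {y. \<forall>x\<in>X. x + y \<in> pole}"

lemma orth_iff: "y \<in> orth X \<longleftrightarrow> (\<forall>x\<in>X. x + y \<in> pole)"
  by (simp add: orth_def)

lemma orthD: "y \<in> orth X \<Longrightarrow> x \<in> X \<Longrightarrow> x + y \<in> pole"
  by (simp add: orth_def)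

lemma orth_antimono: "X \<subseteq> Y \<Longrightarrow> orth Y \<subseteq> orth X"
  by (auto simp: orth_def)

lemma orth_orth_extensive: "X \<subseteq> orth (orth X)"
  by (auto simp: orth_def add.commute)

lemma orth_orth_orth [simp]: "orth (orth (orth X)) = orth X"
  by (meson orth_antimono orth_orth_extensive subset_antisym)

lemma orth_zero [simp]: "orth {0} = pole"
  by (auto simp: orth_def)

lemma orth_pole: "orth (orth pole) = pole"
  using orth_orth_orth[of "{0}"] by simp

lemma orth_Un: "orth (X \<union> Y) = orth X \<inter> orth Y"
  by (auto simp: orth_def)

lemma orth_add_iff: "\<sigma> \<in> orth (X + Y) \<longleftrightarrow> (\<forall>x\<in>X. x + \<sigma> \<in> orth Y)"
  by (auto simp: orth_def set_plus_def ac_simps) (metis add.assoc add.commute)+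

text \<open>By currying, \<open>\<sigma>\<close> is orthogonal to \<open>X + Y\<close> iff every
  \<open>y + \<sigma>\<close> is orthogonal to \<open>X\<close>, and \<open>X\<close> has the same
  orthogonal as its closure. Hence it suffices to test on generators.\<close>

lemma orth_closure_add: "orth (orth (orth X) + Y) = orth (X + Y)"
proof (rule equalityI)
  show "orth (orth (orth X) + Y) \<subseteq> orth (X + Y)"
    by (intro orth_antimono set_plus_mono2 orth_orth_extensive order_refl)
next
  show "orth (X + Y) \<subseteq> orth (orth (orth X) + Y)"
  proof
    fix \<sigma> assume "\<sigma> \<in> orth (X + Y)"
    then have "\<forall>y\<in>Y. y + \<sigma> \<in> orth X"
      by (simp add: add.commute[of X Y] orth_add_iff)
    then have "\<forall>y\<in>Y. y + \<sigma> \<in> orth (orth (orth X))"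
      by simp
    then show "\<sigma> \<in> orth (orth (orth X) + Y)"
      by (simp only: add.commute[of _ Y] orth_add_iff)
  qed
qed

lemma orth_closure_add_right: "orth (X + orth (orth Y)) = orth (X + Y)"
  using orth_closure_add[of Y X] by (simp add: add.commute)

lemma orth_sum_closure:
  "orth (sum_mset (image_mset (\<lambda>A. orth (orth (f A))) M) + Y) = orth (sum_mset (image_mset f M) + Y)"
proof (induction M arbitrary: Y)
  case (add A M)
  let ?S = "\<Sum>A\<in>#M. f A" and ?S' = "\<Sum>A\<in>#M. orth (orth (f A))"
  have "orth ((\<Sum>A\<in>#add_mset A M. orth (orth (f A))) + Y) = orth (orth (orth (f A)) + (?S' + Y))"
    by (simp only: image_mset_add_mset sum_mset.add_mset add.assoc)
  also have "\<dots> = orth (f A + (?S' + Y))"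
    by (rule orth_closure_add)
  also have "\<dots> = orth (?S' + (f A + Y))"
    by (simp only: ac_simps)
  also have "\<dots> = orth (?S + (f A + Y))"
    by (rule add.IH)
  finally show ?case
    by (simp only: image_mset_add_mset sum_mset.add_mset ac_simps)
qed simp

fun sem :: "ll \<Rightarrow> 'm set" where
  "sem (Atom n) = pole"
| "sem (Neg A) = orth (sem A)"
| "sem \<one> = orth pole"
| "sem \<bottom> = pole"
| "sem ATop = UNIV"
| "sem AZero = orth UNIV"
| "sem (A \<otimes> B) = orth (orth (sem A + sem B))"
| "sem (Par A B) = orth (orth (sem A) + orth (sem B))"
| "sem (A \<multimap> B) = orth (sem A + orth (sem B))"
| "sem (With A B) = sem A \<inter> sem B"
| "sem (A \<oplus> B) = orth (orth (sem A) \<inter> orth (sem B))"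
| "sem (OfCourse A) = orth (orth (sem A \<inter> {0}))"
| "sem (WhyNot A) = orth (orth (sem A) \<inter> {0})"

lemma orth_orth_sem [simp]: "orth (orth (sem A)) = sem A"
proof (induction A)
  case (With A B)
  have "sem A \<inter> sem B = orth (orth (sem A) \<union> orth (sem B))"
    by (simp add: orth_Un With)
  then show ?case by simp
next
  case ATop
  show ?case by (auto simp: orth_def) (metis add.commute)
qed (simp_all add: orth_pole)

section \<open>Interpretation of sequents and soundness of the single rules\<close>

definition ante :: "ll multiset \<Rightarrow> 'm set" where
  "ante \<Gamma> = sum_mset (image_mset sem \<Gamma>)"

definition succ :: "ll multiset \<Rightarrow> 'm set" where
  "succ \<Delta> = sum_mset (image_mset (\<lambda>A. orth (sem A)) \<Delta>)"

text \<open>Validity of the sequent is \<open>0 \<in> seq \<Gamma> \<Delta>\<close>. Most rules are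
  proved for an arbitrary element \<open>\<sigma>\<close>, because a nonzero element will later be
  carried through a derivation.\<close>

definition seq :: "ll multiset \<Rightarrow> ll multiset \<Rightarrow> 'm set" where
  "seq \<Gamma> \<Delta> = orth (ante \<Gamma> + succ \<Delta>)"

lemma ante_simps [simp]: "ante {#} = {0}" "ante (add_mset A \<Gamma>) = sem A + ante \<Gamma>"
    "ante (\<Gamma>1 + \<Gamma>2) = ante \<Gamma>1 + ante \<Gamma>2"
  by (simp_all add: ante_def)

lemma succ_simps [simp]: "succ {#} = {0}" "succ (add_mset A \<Delta>) = orth (sem A) + succ \<Delta>"
    "succ (\<Delta>1 + \<Delta>2) = succ \<Delta>1 + succ \<Delta>2"
  by (simp_all add: succ_def)

lemma seq_left: "\<sigma> \<in> seq (add_mset A \<Gamma>) \<Delta> \<longleftrightarrow> (\<forall>a\<in>sem A. a + \<sigma> \<in> seq \<Gamma> \<Delta>)"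
  by (simp add: seq_def add.assoc orth_add_iff)

lemma seq_right: "\<sigma> \<in> seq \<Gamma> (add_mset A \<Delta>) \<longleftrightarrow> (\<forall>a\<in>orth (sem A). a + \<sigma> \<in> seq \<Gamma> \<Delta>)"
  by (simp add: seq_def add.left_commute[of "ante \<Gamma>"] orth_add_iff)

lemma seq_closure:
  assumes "\<And>x. x \<in> X \<Longrightarrow> x + \<sigma> \<in> seq \<Gamma> \<Delta>" "a \<in> orth (orth X)"
  shows "a + \<sigma> \<in> seq \<Gamma> \<Delta>"
proof -
  have "\<sigma> \<in> orth (X + (ante \<Gamma> + succ \<Delta>))"
    using assms(1) by (simp add: orth_add_iff seq_def)
  then have "\<sigma> \<in> orth (orth (orth X) + (ante \<Gamma> + succ \<Delta>))"
    by (simp only: orth_closure_add)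
  then show ?thesis
    using assms(2) by (simp add: orth_add_iff seq_def)
qed

lemma seq_left_closure:
  assumes "sem A = orth (orth X)" "\<And>x. x \<in> X \<Longrightarrow> x + \<sigma> \<in> seq \<Gamma> \<Delta>"
  shows "\<sigma> \<in> seq (add_mset A \<Gamma>) \<Delta>"
  unfolding seq_left assms(1) using assms(2) by (blast intro: seq_closure)

lemma seq_right_closure:
  assumes "orth (sem A) = orth (orth X)" "\<And>x. x \<in> X \<Longrightarrow> x + \<sigma> \<in> seq \<Gamma> \<Delta>"
  shows "\<sigma> \<in> seq \<Gamma> (add_mset A \<Delta>)"
  unfolding seq_right assms(1) using assms(2) by (blast intro: seq_closure)

lemma seq_split:
  assumes "\<And>u v. u \<in> ante \<Gamma>1 + succ \<Delta>1 \<Longrightarrow> v \<in> ante \<Gamma>2 + succ \<Delta>2 \<Longrightarrow> (u + \<sigma>1) + (v + \<sigma>2) \<in> pole"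
  shows "\<sigma>1 + \<sigma>2 \<in> seq (\<Gamma>1 + \<Gamma>2) (\<Delta>1 + \<Delta>2)"
proof -
  have eq: "ante (\<Gamma>1 + \<Gamma>2) + succ (\<Delta>1 + \<Delta>2) = (ante \<Gamma>1 + succ \<Delta>1) + (ante \<Gamma>2 + succ \<Delta>2)"
    by (simp add: ac_simps)
  have "x + (\<sigma>1 + \<sigma>2) \<in> pole" if "x \<in> (ante \<Gamma>1 + succ \<Delta>1) + (ante \<Gamma>2 + succ \<Delta>2)" for x
  proof -
    from that obtain u v where "x = u + v" "u \<in> ante \<Gamma>1 + succ \<Delta>1" "v \<in> ante \<Gamma>2 + succ \<Delta>2"
      by (rule set_plus_elim)
    with assms[of u v] show ?thesis by (simp add: ac_simps)
  qed
  then show ?thesis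
    unfolding seq_def eq orth_iff by blast
qed

lemma seq_right_sem:
  assumes "\<sigma> \<in> seq \<Gamma> (add_mset A \<Delta>)" "u \<in> ante \<Gamma> + succ \<Delta>"
  shows "u + \<sigma> \<in> sem A"
proof -
  have "\<sigma> \<in> orth ((ante \<Gamma> + succ \<Delta>) + orth (sem A))"
    using assms(1) by (simp add: seq_def ac_simps)
  then have "u + \<sigma> \<in> orth (orth (sem A))"
    using assms(2) by (simp add: orth_add_iff)
  then show ?thesis by simp
qed

lemma seq_left_orth:
  assumes "\<sigma> \<in> seq (add_mset A \<Gamma>) \<Delta>" "u \<in> ante \<Gamma> + succ \<Delta>"
  shows "u + \<sigma> \<in> orth (sem A)"
proof -
  have "\<sigma> \<in> orth ((ante \<Gamma> + succ \<Delta>) + sem A)"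
    using assms(1) by (simp add: seq_def ac_simps)
  then show ?thesis
    using assms(2) by (simp add: orth_add_iff)
qed

lemma seq_ax: "0 \<in> seq {#A#} {#A#}"
  by (auto simp: seq_def orth_iff set_plus_def)

lemma seq_neg_L: "\<sigma> \<in> seq \<Gamma> (add_mset A \<Delta>) \<Longrightarrow> \<sigma> \<in> seq (add_mset (Neg A) \<Gamma>) \<Delta>"
  by (simp add: seq_left seq_right)

lemma seq_neg_R: "\<sigma> \<in> seq (add_mset A \<Gamma>) \<Delta> \<Longrightarrow> \<sigma> \<in> seq \<Gamma> (add_mset (Neg A) \<Delta>)"
  by (simp add: seq_left seq_right)

lemma seq_one_L: "\<sigma> \<in> seq \<Gamma> \<Delta> \<Longrightarrow> \<sigma> \<in> seq (add_mset \<one> \<Gamma>) \<Delta>"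
  by (rule seq_left_closure[of _ "{0}"]) simp_all

lemma seq_one_R: "0 \<in> seq {#} {#\<one>#}"
  by (simp add: seq_def orth_pole orth_iff)

lemma seq_bot_L: "0 \<in> seq {#\<bottom>#} {#}"
  by (simp add: seq_def orth_iff)

lemma seq_bot_R: "\<sigma> \<in> seq \<Gamma> \<Delta> \<Longrightarrow> \<sigma> \<in> seq \<Gamma> (add_mset \<bottom> \<Delta>)"
  by (rule seq_right_closure[of _ "{0}"]) simp_all

lemma seq_top_R: "0 \<in> seq \<Gamma> (add_mset ATop \<Delta>)"
  by (auto simp: seq_right seq_def orth_iff set_plus_def) (metis add.assoc add.commute)

lemma seq_zero_L: "0 \<in> seq (add_mset AZero \<Gamma>) \<Delta>"
  by (auto simp: seq_left seq_def orth_iff set_plus_def) (metis add.assoc add.commute)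

lemma seq_tensor_L:
  "\<sigma> \<in> seq (add_mset A (add_mset B \<Gamma>)) \<Delta> \<Longrightarrow> \<sigma> \<in> seq (add_mset (A \<otimes> B) \<Gamma>) \<Delta>"
  by (simp add: seq_def add.assoc orth_closure_add)

lemma seq_par_R:
  "\<sigma> \<in> seq \<Gamma> (add_mset A (add_mset B \<Delta>)) \<Longrightarrow> \<sigma> \<in> seq \<Gamma> (add_mset (Par A B) \<Delta>)"
  by (simp add: seq_def add.left_commute[of "ante \<Gamma>"] add.assoc orth_closure_add)

lemma seq_limp_R:
  "\<sigma> \<in> seq (add_mset A \<Gamma>) (add_mset B \<Delta>) \<Longrightarrow> \<sigma> \<in> seq \<Gamma> (add_mset (A \<multimap> B) \<Delta>)"
  by (simp add: seq_def add.left_commute[of "ante \<Gamma>"] add.assoc orth_closure_add)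

lemma seq_tensor_R:
  assumes "\<sigma>1 \<in> seq \<Gamma>1 (add_mset A \<Delta>1)" "\<sigma>2 \<in> seq \<Gamma>2 (add_mset B \<Delta>2)"
  shows "\<sigma>1 + \<sigma>2 \<in> seq (\<Gamma>1 + \<Gamma>2) (add_mset (A \<otimes> B) (\<Delta>1 + \<Delta>2))"
  unfolding seq_right
proof
  fix w assume w: "w \<in> orth (sem (A \<otimes> B))"
  have "(w + \<sigma>1) + \<sigma>2 \<in> seq (\<Gamma>1 + \<Gamma>2) (\<Delta>1 + \<Delta>2)"
  proof (rule seq_split)
    fix u v assume "u \<in> ante \<Gamma>1 + succ \<Delta>1" "v \<in> ante \<Gamma>2 + succ \<Delta>2"
    then have "(u + \<sigma>1) + (v + \<sigma>2) \<in> sem A + sem B"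
      using assms by (intro set_plus_intro) (auto intro: seq_right_sem)
    then show "u + (w + \<sigma>1) + (v + \<sigma>2) \<in> pole"
      using orthD[of w "sem A + sem B" "(u + \<sigma>1) + (v + \<sigma>2)"] w by (simp add: ac_simps)
  qed
  then show "w + (\<sigma>1 + \<sigma>2) \<in> seq (\<Gamma>1 + \<Gamma>2) (\<Delta>1 + \<Delta>2)"
    by (simp add: ac_simps)
qed

lemma seq_par_L:
  assumes "\<sigma>1 \<in> seq (add_mset A \<Gamma>1) \<Delta>1" "\<sigma>2 \<in> seq (add_mset B \<Gamma>2) \<Delta>2"
  shows "\<sigma>1 + \<sigma>2 \<in> seq (add_mset (Par A B) (\<Gamma>1 + \<Gamma>2)) (\<Delta>1 + \<Delta>2)"
  unfolding seq_left
proof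
  fix w assume w: "w \<in> sem (Par A B)"
  have "(w + \<sigma>1) + \<sigma>2 \<in> seq (\<Gamma>1 + \<Gamma>2) (\<Delta>1 + \<Delta>2)"
  proof (rule seq_split)
    fix u v assume "u \<in> ante \<Gamma>1 + succ \<Delta>1" "v \<in> ante \<Gamma>2 + succ \<Delta>2"
    then have "(u + \<sigma>1) + (v + \<sigma>2) \<in> orth (sem A) + orth (sem B)"
      using assms by (intro set_plus_intro) (auto intro: seq_left_orth)
    then show "u + (w + \<sigma>1) + (v + \<sigma>2) \<in> pole"
      using orthD[of w "orth (sem A) + orth (sem B)" "(u + \<sigma>1) + (v + \<sigma>2)"] w by (simp add: ac_simps)
  qed
  then show "w + (\<sigma>1 + \<sigma>2) \<in> seq (\<Gamma>1 + \<Gamma>2) (\<Delta>1 + \<Delta>2)"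
    by (simp add: ac_simps)
qed

lemma seq_limp_L:
  assumes "\<sigma>1 \<in> seq \<Gamma>1 (add_mset A \<Delta>1)" "\<sigma>2 \<in> seq (add_mset B \<Gamma>2) \<Delta>2"
  shows "\<sigma>1 + \<sigma>2 \<in> seq (add_mset (A \<multimap> B) (\<Gamma>1 + \<Gamma>2)) (\<Delta>1 + \<Delta>2)"
  unfolding seq_left
proof
  fix w assume w: "w \<in> sem (A \<multimap> B)"
  have "(w + \<sigma>1) + \<sigma>2 \<in> seq (\<Gamma>1 + \<Gamma>2) (\<Delta>1 + \<Delta>2)"
  proof (rule seq_split)
    fix u v assume "u \<in> ante \<Gamma>1 + succ \<Delta>1" "v \<in> ante \<Gamma>2 + succ \<Delta>2"
    then have "(u + \<sigma>1) + (v + \<sigma>2) \<in> sem A + orth (sem B)"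
      using assms by (intro set_plus_intro) (auto intro: seq_left_orth seq_right_sem)
    then show "u + (w + \<sigma>1) + (v + \<sigma>2) \<in> pole"
      using orthD[of w "sem A + orth (sem B)" "(u + \<sigma>1) + (v + \<sigma>2)"] w by (simp add: ac_simps)
  qed
  then show "w + (\<sigma>1 + \<sigma>2) \<in> seq (\<Gamma>1 + \<Gamma>2) (\<Delta>1 + \<Delta>2)"
    by (simp add: ac_simps)
qed

lemma seq_with_R:
  assumes "\<sigma> \<in> seq \<Gamma> (add_mset A \<Delta>)" "\<sigma> \<in> seq \<Gamma> (add_mset B \<Delta>)"
  shows "\<sigma> \<in> seq \<Gamma> (add_mset (With A B) \<Delta>)"
  by (rule seq_right_closure[of _ "orth (sem A) \<union> orth (sem B)"])
     (use assms in \<open>auto simp: orth_Un seq_right\<close>)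

lemma seq_plus_L:
  assumes "\<sigma> \<in> seq (add_mset A \<Gamma>) \<Delta>" "\<sigma> \<in> seq (add_mset B \<Gamma>) \<Delta>"
  shows "\<sigma> \<in> seq (add_mset (A \<oplus> B) \<Gamma>) \<Delta>"
  by (rule seq_left_closure[of _ "sem A \<union> sem B"])
     (use assms in \<open>auto simp: orth_Un seq_left\<close>)

lemma seq_plus_R1: "\<sigma> \<in> seq \<Gamma> (add_mset A \<Delta>) \<Longrightarrow> \<sigma> \<in> seq \<Gamma> (add_mset (A \<oplus> B) \<Delta>)"
  and seq_plus_R2: "\<sigma> \<in> seq \<Gamma> (add_mset B \<Delta>) \<Longrightarrow> \<sigma> \<in> seq \<Gamma> (add_mset (A \<oplus> B) \<Delta>)"
  by (simp_all add: seq_right flip: orth_Un) (simp_all add: orth_Un)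

lemma seq_with_L1: "\<sigma> \<in> seq (add_mset A \<Gamma>) \<Delta> \<Longrightarrow> \<sigma> \<in> seq (add_mset (With A B) \<Gamma>) \<Delta>"
  and seq_with_L2: "\<sigma> \<in> seq (add_mset B \<Gamma>) \<Delta> \<Longrightarrow> \<sigma> \<in> seq (add_mset (With A B) \<Gamma>) \<Delta>"
  by (simp_all add: seq_left)

lemma orth_whynot: "orth (sem (WhyNot A)) = orth (orth (orth (sem A) \<inter> {0}))"
  by simp

lemma seq_bang_L:
  "\<sigma> \<in> seq (add_mset A \<Gamma>) \<Delta> \<Longrightarrow> \<sigma> \<in> seq (add_mset (OfCourse A) \<Gamma>) \<Delta>"
  by (rule seq_left_closure[OF sem.simps(12)]) (auto simp: seq_left)

lemma seq_bang_W: "\<sigma> \<in> seq \<Gamma> \<Delta> \<Longrightarrow> \<sigma> \<in> seq (add_mset (OfCourse A) \<Gamma>) \<Delta>"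
  by (rule seq_left_closure[OF sem.simps(12)]) (auto simp: seq_left)

lemma zero_in_bang: "0 \<in> sem A \<Longrightarrow> 0 \<in> sem (OfCourse A)"
  using orth_orth_extensive[of "sem A \<inter> {0}"] by auto

lemma seq_bang_C:
  assumes "\<sigma> \<in> seq (add_mset (OfCourse A) (add_mset (OfCourse A) \<Gamma>)) \<Delta>"
  shows "\<sigma> \<in> seq (add_mset (OfCourse A) \<Gamma>) \<Delta>"
proof -
  have "0 \<in> sem A \<Longrightarrow> \<sigma> \<in> seq \<Gamma> \<Delta>"
    using assms zero_in_bang[of A] unfolding seq_left by (metis add.left_neutral)
  then have "x + \<sigma> \<in> seq \<Gamma> \<Delta>" if "x \<in> sem A \<inter> {0}" for x
    using that by (metis Int_iff add.left_neutral singletonD)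
  then show ?thesis
    by (rule seq_left_closure[OF sem.simps(12)])
qed

lemma seq_quest_R:
  "\<sigma> \<in> seq \<Gamma> (add_mset A \<Delta>) \<Longrightarrow> \<sigma> \<in> seq \<Gamma> (add_mset (WhyNot A) \<Delta>)"
  by (rule seq_right_closure[OF orth_whynot]) (auto simp: seq_right)

lemma seq_quest_W: "\<sigma> \<in> seq \<Gamma> \<Delta> \<Longrightarrow> \<sigma> \<in> seq \<Gamma> (add_mset (WhyNot A) \<Delta>)"
  by (rule seq_right_closure[OF orth_whynot]) (auto simp: seq_right)

lemma seq_quest_C:
  assumes "\<sigma> \<in> seq \<Gamma> (add_mset (WhyNot A) (add_mset (WhyNot A) \<Delta>))"
  shows "\<sigma> \<in> seq \<Gamma> (add_mset (WhyNot A) \<Delta>)"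
proof -
  have "0 \<in> orth (sem (WhyNot A))" if "0 \<in> orth (sem A)"
    using orth_orth_extensive[of "orth (sem A) \<inter> {0}"] that by auto
  then have "0 \<in> orth (sem A) \<Longrightarrow> \<sigma> \<in> seq \<Gamma> \<Delta>"
    using assms unfolding seq_right by (metis add.left_neutral)
  then have "x + \<sigma> \<in> seq \<Gamma> \<Delta>" if "x \<in> orth (sem A) \<inter> {0}" for x
    using that by (metis Int_iff add.left_neutral singletonD)
  then show ?thesis
    by (rule seq_right_closure[OF orth_whynot])
qed

text \<open>Under \<open>orth\<close> the closures in an exponential context may be dropped; what
  remains are sums of subsets of \<open>{0}\<close>.\<close>

lemma seq_exponential_context:
  "orth (X + (ante (image_mset OfCourse \<Gamma>) + succ (image_mset WhyNot \<Delta>)))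
   = orth (X + ((\<Sum>A\<in>#\<Gamma>. sem A \<inter> {0}) + (\<Sum>A\<in>#\<Delta>. orth (sem A) \<inter> {0})))"
proof -
  have a: "ante (image_mset OfCourse \<Gamma>) = (\<Sum>A\<in>#\<Gamma>. orth (orth (sem A \<inter> {0})))"
    and s: "succ (image_mset WhyNot \<Delta>) = (\<Sum>A\<in>#\<Delta>. orth (orth (orth (sem A) \<inter> {0})))"
    by (simp_all add: ante_def succ_def image_mset.compositionality comp_def)
  let ?a = "\<Sum>A\<in>#\<Gamma>. sem A \<inter> {0}" and ?s = "\<Sum>A\<in>#\<Delta>. orth (sem A) \<inter> {0}"
  let ?s' = "\<Sum>A\<in>#\<Delta>. orth (orth (orth (sem A) \<inter> {0}))"
  have "orth (X + ((\<Sum>A\<in>#\<Gamma>. orth (orth (sem A \<inter> {0}))) + ?s'))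
      = orth ((\<Sum>A\<in>#\<Gamma>. orth (orth (sem A \<inter> {0}))) + (?s' + X))"
    by (simp only: ac_simps)
  also have "\<dots> = orth (?a + (?s' + X))"
    by (rule orth_sum_closure)
  also have "\<dots> = orth (?s' + (?a + X))"
    by (simp only: ac_simps)
  also have "\<dots> = orth (?s + (?a + X))"
    by (rule orth_sum_closure)
  also have "\<dots> = orth (X + (?a + ?s))"
    by (simp only: ac_simps)
  finally show ?thesis
    unfolding a s .
qed

lemma sum_subset_zero: "(\<And>A. f A \<subseteq> {0}) \<Longrightarrow> (\<Sum>A\<in>#M. f A) \<subseteq> {0::'m}"
proof (induction M)
  case (add A M)
  then have "f A + (\<Sum>A\<in>#M. f A) \<subseteq> {0} + {0}"
    by (meson set_plus_mono2)
  then show ?case by simp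
qed simp

text \<open>The exponential context amounts to a set \<open>C\<close> that is empty or
  \<open>{0}\<close>. If it is empty, both orthogonals are everything; if it is \<open>{0}\<close>,
  the assumption puts \<open>0\<close> into \<open>orth X\<close>, and the claim becomes that the
  pole is contained in itself. The same argument covers promotion on the right and its dual on the
  left.\<close>

lemma promotion:
  assumes "0 \<in> orth (X + (ante (image_mset OfCourse \<Gamma>) + succ (image_mset WhyNot \<Delta>)))"
  shows "0 \<in> orth (orth (orth X \<inter> {0}) + (ante (image_mset OfCourse \<Gamma>) + succ (image_mset WhyNot \<Delta>)))"
proof -
  define C where "C = (\<Sum>A\<in>#\<Gamma>. sem A \<inter> {0}) + (\<Sum>A\<in>#\<Delta>. orth (sem A) \<inter> {0})"
  have "C \<subseteq> {0} + {0}"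
    unfolding C_def by (intro set_plus_mono2 sum_subset_zero) auto
  then have C0: "C \<subseteq> {0}" by simp
  have "0 \<in> orth (X + C)"
    using assms unfolding seq_exponential_context C_def .
  then have "0 \<in> orth (orth (orth X \<inter> {0}) + C)"
    using C0 by (fastforce simp: orth_iff set_plus_def)
  then show ?thesis
    unfolding seq_exponential_context C_def .
qed

lemma seq_bang_R:
  assumes "0 \<in> seq (image_mset OfCourse \<Gamma>) (add_mset A (image_mset WhyNot \<Delta>))"
  shows "0 \<in> seq (image_mset OfCourse \<Gamma>) (add_mset (OfCourse A) (image_mset WhyNot \<Delta>))"
  using assms promotion[of "orth (sem A)" \<Gamma> \<Delta>] by (simp add: seq_def ac_simps)

lemma seq_quest_L:
  assumes "0 \<in> seq (add_mset A (image_mset OfCourse \<Gamma>)) (image_mset WhyNot \<Delta>)"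
  shows "0 \<in> seq (add_mset (WhyNot A) (image_mset OfCourse \<Gamma>)) (image_mset WhyNot \<Delta>)"
  using assms promotion[of "sem A" \<Gamma> \<Delta>] by (simp add: seq_def ac_simps)

lemma soundness: "LL k \<Gamma> \<Delta> \<Longrightarrow> 0 \<in> seq \<Gamma> \<Delta>"
proof (induction rule: LL.induct)
  case (tensor_R k1 \<Gamma>1 A \<Delta>1 k2 \<Gamma>2 B \<Delta>2)
  then show ?case using seq_tensor_R[of 0 _ _ _ 0] by simp
next
  case (par_L k1 A \<Gamma>1 \<Delta>1 k2 B \<Gamma>2 \<Delta>2)
  then show ?case using seq_par_L[of 0 _ _ _ 0] by simp
next
  case (limp_L k1 \<Gamma>1 A \<Delta>1 k2 B \<Gamma>2 \<Delta>2)
  then show ?case using seq_limp_L[of 0 _ _ _ 0] by simp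
qed (rule seq_ax seq_one_R seq_bot_L seq_top_R seq_zero_L
      seq_neg_L seq_neg_R seq_one_L seq_bot_R seq_tensor_L seq_par_R seq_limp_R
      seq_with_L1 seq_with_L2 seq_plus_R1 seq_plus_R2
      seq_bang_L seq_bang_W seq_bang_C seq_bang_R seq_quest_R seq_quest_W seq_quest_C seq_quest_L
      seq_with_R seq_plus_L; assumption)+

section \<open>Detecting derelictions semantically\<close>

fun multiplicative :: "ll \<Rightarrow> bool" where
  "multiplicative \<bottom> \<longleftrightarrow> True"
| "multiplicative (A \<otimes> B) \<longleftrightarrow> multiplicative A \<and> multiplicative B"
| "multiplicative (A \<multimap> B) \<longleftrightarrow> multiplicative A \<and> multiplicative B"
| "multiplicative _ \<longleftrightarrow> False"

text \<open>
  An element \<open>\<tau>\<close> that belongs to \<open>B\<close> whenever \<open>0\<close> does records that \<open>!B\<close> has been derelicted: it is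
  absorbed at an application of \<open>L!\<close> and otherwise passed on to one premise.  This would fail for
  the additive rules that share a context, which is why additives are only allowed inside \<open>!B\<close>.
\<close>

definition marked :: "'m \<Rightarrow> ll \<Rightarrow> bool" where
  "marked \<tau> A \<longleftrightarrow> multiplicative A \<or> (\<exists>B. A = OfCourse B \<and> (0 \<in> sem B \<longrightarrow> \<tau> \<in> sem B))"

lemma marked_simps [simp]: "marked \<tau> (A \<otimes> B) \<longleftrightarrow> multiplicative A \<and> multiplicative B"
  "marked \<tau> (A \<multimap> B) \<longleftrightarrow> multiplicative A \<and> multiplicative B"
  "multiplicative A \<Longrightarrow> marked \<tau> A"
  "marked \<tau> (OfCourse B) \<longleftrightarrow> (0 \<in> sem B \<longrightarrow> \<tau> \<in> sem B)"
  "marked \<tau> (With A B) \<longleftrightarrow> False" "marked \<tau> (A \<oplus> B) \<longleftrightarrow> False" "marked \<tau> (Neg A) \<longleftrightarrow> False"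
  "marked \<tau> (Par A B) \<longleftrightarrow> False" "marked \<tau> (WhyNot A) \<longleftrightarrow> False" "marked \<tau> \<one> \<longleftrightarrow> False"
  by (auto simp: marked_def)

text \<open>If \<open>k > 0\<close>, some premise still contains a dereliction; it receives
  \<open>\<tau>\<close>, and the other premise of a binary rule receives \<open>0\<close> from plain
  soundness. At \<open>L!\<close> the premise need not be marked any more, since the body of the
  bang is arbitrary there; \<open>\<tau>\<close> is absorbed by that body and plain soundness
  finishes.\<close>

lemma soundness_dereliction:
  assumes "LL k \<Gamma> \<Delta>" "k > 0" "\<forall>A\<in>#\<Gamma>. marked \<tau> A" "\<forall>A\<in>#\<Delta>. multiplicative A"
  shows "\<tau> \<in> seq \<Gamma> \<Delta>"
  using assms
proof (induction rule: LL.induct)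
  case (tensor_R k1 \<Gamma>1 A \<Delta>1 k2 \<Gamma>2 B \<Delta>2)
  then consider "k1 > 0" | "k2 > 0" by auto
  then show ?case
  proof cases
    case 1
    then show ?thesis
      using seq_tensor_R[of \<tau> _ _ _ 0] tensor_R soundness[OF tensor_R.hyps(2)] by simp
  next
    case 2
    then show ?thesis
      using seq_tensor_R[of 0 _ _ _ \<tau>] tensor_R soundness[OF tensor_R.hyps(1)] by simp
  qed
next
  case (limp_L k1 \<Gamma>1 A \<Delta>1 k2 B \<Gamma>2 \<Delta>2)
  then consider "k1 > 0" | "k2 > 0" by auto
  then show ?case
  proof cases
    case 1
    then show ?thesis
      using seq_limp_L[of \<tau> _ _ _ 0] limp_L soundness[OF limp_L.hyps(2)] by simp
  next
    case 2
    then show ?thesis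
      using seq_limp_L[of 0 _ _ _ \<tau>] limp_L soundness[OF limp_L.hyps(1)] by simp
  qed
next
  case (bang_L k A \<Gamma> \<Delta>)
  have "\<tau> \<in> seq \<Gamma> \<Delta>" if "0 \<in> sem A"
  proof -
    have "\<tau> \<in> sem A" using bang_L.prems that by simp
    then show ?thesis
      using soundness[OF bang_L.hyps] by (simp add: seq_left)
  qed
  \<comment> \<open>If \<open>0\<close> is not in \<open>sem A\<close>, the set of generators is
    empty and nothing has to be tested.\<close>
  then have "x + \<tau> \<in> seq \<Gamma> \<Delta>" if "x \<in> sem A \<inter> {0}" for x
    using that by (metis Int_iff add.left_neutral singletonD)
  then show ?case
    by (rule seq_left_closure[OF sem.simps(12)])
next
  case (bang_C k A \<Gamma> \<Delta>)
  then have "\<tau> \<in> seq (add_mset (OfCourse A) (add_mset (OfCourse A) \<Gamma>)) \<Delta>" by simp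
  then show ?case by (rule seq_bang_C)
qed (auto intro: seq_bot_R seq_tensor_L seq_limp_R seq_bang_W)

end

section \<open>Composition of programs\<close>

fun seq_program :: "program \<Rightarrow> program \<Rightarrow> program" where
  "seq_program Output Q = Q"
| "seq_program (Step l P) Q = Step l (seq_program P Q)"
| "seq_program (Diverge X Y1 P1 Y2 P2) Q = Diverge X Y1 (seq_program P1 Q) Y2 (seq_program P2 Q)"

lemma labels_ok_seq_program:
  "labels_ok N (seq_program P Q) \<longleftrightarrow> labels_ok N P \<and> labels_ok N Q"
  by (induction P) auto

lemma bracketed_seq_program:
  "bracketed d P \<Longrightarrow> bracketed e Q \<Longrightarrow> bracketed (d + e) (seq_program P Q)"
proof (induction d P rule: bracketed.induct)
  case (4 d V P)
  then show ?case by (cases d) auto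
qed auto

text \<open>Here \<open>d\<close> pushes are open inside the subtree and \<open>e\<close> pushes are
  open above the one considered. By the bracketing hypothesis every path pops all of them within
  \<open>P\<close>, so the partner is met before \<open>Q\<close> is reached.\<close>

lemma pop_partners_seq_program:
  "bracketed (Suc (d + e)) P \<Longrightarrow> pop_partners d (seq_program P Q) = pop_partners d P"
proof (induction d P arbitrary: e rule: pop_partners.induct)
  case (4 d V P)
  then show ?case by (cases d) auto
next
  case (5 d X Y1 P1 Y2 P2)
  then show ?case by (metis bracketed.simps(5) pop_partners.simps(5) seq_program.simps(3))
qed auto

lemma pop_partners_seq_program_pop:
  "bracketed d P \<Longrightarrow> pop_partners d (seq_program P (Step (POP V) Q)) = {V}"
  by (induction d P rule: pop_partners.induct) auto

lemma uses_seq_program: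
  "bracketed d (Step l P) \<Longrightarrow> uses l (seq_program P Q) = uses l P"
  using pop_partners_seq_program[of 0 d P Q] by (cases l) auto

lemma drawn_Step:
  "drawn \<Gamma> \<Delta> (Step l P) \<longleftrightarrow> (\<exists>V. l = POP V) \<and> drawn \<Gamma> \<Delta> P \<or>
     (\<exists>A \<in> uses l P. A \<in># \<Gamma> \<and> drawn \<Gamma> \<Delta> P \<or> A \<in># \<Delta> \<and> drawn \<Gamma> (\<Delta> - {#A#}) P)"
  by (cases l) auto

lemma drawn_seq_program:
  "drawn \<Gamma> \<Delta> P \<Longrightarrow> bracketed d P \<Longrightarrow> drawn \<Gamma> \<Delta>' Q \<Longrightarrow> drawn \<Gamma> (\<Delta> + \<Delta>') (seq_program P Q)"
proof (induction P arbitrary: \<Delta> d)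
  case (Step l P)
  have br: "\<exists>d. bracketed d P"
    using Step.prems(2) by (cases l) auto
  then have IH: "drawn \<Gamma> \<Delta> P \<Longrightarrow> drawn \<Gamma> (\<Delta> + \<Delta>') (seq_program P Q)" for \<Delta>
    using Step.IH Step.prems(3) by blast
  have diff: "A \<in># \<Delta> \<Longrightarrow> \<Delta> + \<Delta>' - {#A#} = \<Delta> - {#A#} + \<Delta>'" for A
    by simp
  show ?case
    using Step.prems(1) IH diff unfolding seq_program.simps drawn_Step
      uses_seq_program[OF Step.prems(2)]
    by (metis union_iff)
next
  case (Diverge X Y1 P1 Y2 P2)
  have IH: "drawn \<Gamma> \<Delta> P1 \<Longrightarrow> drawn \<Gamma> (\<Delta> + \<Delta>') (seq_program P1 Q)"
    "drawn \<Gamma> \<Delta> P2 \<Longrightarrow> drawn \<Gamma> (\<Delta> + \<Delta>') (seq_program P2 Q)" for \<Delta>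
    using Diverge.IH[of _ d] Diverge.prems(2,3) by auto
  have IH': "A \<in># \<Delta> \<Longrightarrow> drawn \<Gamma> (\<Delta> - {#A#}) P1 \<Longrightarrow> drawn \<Gamma> (\<Delta> + \<Delta>' - {#A#}) (seq_program P1 Q)"
    "A \<in># \<Delta> \<Longrightarrow> drawn \<Gamma> (\<Delta> - {#A#}) P2 \<Longrightarrow> drawn \<Gamma> (\<Delta> + \<Delta>' - {#A#}) (seq_program P2 Q)" for A
    using IH[of "\<Delta> - {#A#}"] by simp_all
  show ?case
    using Diverge.prems(1) IH[of \<Delta>] IH' unfolding seq_program.simps drawn.simps Let_def union_iff
    by blast
qed auto

lemma outputs_None: "outputs P None = {None}"
  by (induction P) auto

lemma outputs_seq_program: "outputs (seq_program P Q) s = (\<Union>t \<in> outputs P s. outputs Q t)"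
  by (induction P arbitrary: s) auto

lemma exec_frame: "exec l (x, st) = Some (y, st1) \<Longrightarrow> exec l (x, st @ st') = Some (y, st1 @ st')"
proof (cases l)
  case (POP V)
  then show "exec l (x, st) = Some (y, st1) \<Longrightarrow> ?thesis"
    by (cases st) (auto split: if_splits)
qed (auto split: if_splits)

text \<open>No instruction looks below the entries that it pops, so extra entries at the bottom of
  the stack survive a successful run. Undefinedness propagates to the leaves; hence success at the
  leaves gives success of each single step.\<close>

lemma outputs_frame:
  assumes "outputs P (Some (x, st)) \<subseteq> {Some (Z, [])}"
  shows "outputs P (Some (x, st @ st')) \<subseteq> {Some (Z, st')}"
proof -
  have step: "\<exists>y st1. exec l (x, st) = Some (y, st1)"
    if "outputs P (Option.bind (Some (x, st)) (exec l)) \<subseteq> {Some (Z, [])}" for l x st P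
    using that by (cases "exec l (x, st)") (auto simp: outputs_None)
  show ?thesis
    using assms
  proof (induction P arbitrary: x st)
    case (Step l P)
    obtain y st1 where 1: "exec l (x, st) = Some (y, st1)"
      using step[of P x st l] Step.prems by auto
    show ?case
      using Step.IH[of y st1] Step.prems exec_frame[OF 1] 1 by simp
  next
    case (Diverge X Y1 P1 Y2 P2)
    obtain y st1 where 1: "exec (HORN X Y1) (x, st) = Some (y, st1)"
      using step[of P1 x st "HORN X Y1"] Diverge.prems by auto
    obtain z st2 where 2: "exec (HORN X Y2) (x, st) = Some (z, st2)"
      using step[of P2 x st "HORN X Y2"] Diverge.prems by auto
    show ?case
      using Diverge.IH(1)[of y st1] Diverge.IH(2)[of z st2] Diverge.prems
        exec_frame[OF 1] exec_frame[OF 2] 1 2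
      by (simp del: exec.simps)
  qed auto
qed

section \<open>Solvability, extended backwards at the root of a program\<close>

definition solvable ::
  "nat \<Rightarrow> product nform multiset \<Rightarrow> product \<Rightarrow> product nform multiset \<Rightarrow> product \<Rightarrow> bool" where
  "solvable N \<Gamma> W \<Delta> Z \<longleftrightarrow> (\<exists>P. strong_solution N P {#W#} \<Delta> \<Gamma> Z)"

lemma strong_solution_single:
  "strong_solution N P {#W#} \<Delta> \<Gamma> Z \<longleftrightarrow> labels_ok N P \<and> bracketed 0 P \<and>
     outputs P (Some (W, [])) \<subseteq> {Some (Z, [])} \<and> drawn \<Gamma> \<Delta> P"
  by (auto simp: strong_solution_def one_stack_acyclic_def computes_def)

lemma solvable_refl: "solvable N \<Gamma> W {#} W"
  unfolding solvable_def strong_solution_single by (intro exI[of _ Output]) auto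

text \<open>Bookkeeping for one use of \<open>A\<close>: \<open>\<Delta>'\<close> is what must be
  used from here on, \<open>\<Delta>\<close> what remains afterwards. It treats reusable formulas
  and those to be used exactly once uniformly.\<close>

definition consumes ::
  "product nform multiset \<Rightarrow> product nform multiset \<Rightarrow> product nform \<Rightarrow> product nform multiset \<Rightarrow> bool" where
  "consumes \<Gamma> \<Delta>' A \<Delta> \<longleftrightarrow> A \<in># \<Gamma> \<and> \<Delta>' = \<Delta> \<or> \<Delta>' = add_mset A \<Delta>"

lemma solvable_horn:
  assumes "solvable N \<Gamma> (x + Y) \<Delta> Z" "A \<in> uses (HORN X Y) Output" "consumes \<Gamma> \<Delta>' A \<Delta>"
    and "simple_product N X" "simple_product N Y"
  shows "solvable N \<Gamma> (x + X) \<Delta>' Z"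
proof -
  obtain P where P: "labels_ok N P" "bracketed 0 P"
    "outputs P (Some (x + Y, [])) \<subseteq> {Some (Z, [])}" "drawn \<Gamma> \<Delta> P"
    using assms(1) by (auto simp: solvable_def strong_solution_single)
  have "drawn \<Gamma> \<Delta>' (Step (HORN X Y) P)"
    unfolding drawn_Step using assms(2,3) P(4) by (auto simp: consumes_def)
  then show ?thesis
    unfolding solvable_def strong_solution_single using P assms(4,5)
    by (intro exI[of _ "Step (HORN X Y) P"]) (simp add: add.commute)
qed

lemma solvable_plus:
  assumes "solvable N \<Gamma> (x + Y1) \<Delta> Z" "solvable N \<Gamma> (x + Y2) \<Delta> Z"
    and "consumes \<Gamma> \<Delta>' (PlusHorn X Y1 Y2) \<Delta>"
    and "simple_product N X" "simple_product N Y1" "simple_product N Y2"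
  shows "solvable N \<Gamma> (x + X) \<Delta>' Z"
proof -
  obtain P1 where P1: "labels_ok N P1" "bracketed 0 P1"
    "outputs P1 (Some (x + Y1, [])) \<subseteq> {Some (Z, [])}" "drawn \<Gamma> \<Delta> P1"
    using assms(1) by (auto simp: solvable_def strong_solution_single)
  obtain P2 where P2: "labels_ok N P2" "bracketed 0 P2"
    "outputs P2 (Some (x + Y2, [])) \<subseteq> {Some (Z, [])}" "drawn \<Gamma> \<Delta> P2"
    using assms(2) by (auto simp: solvable_def strong_solution_single)
  have "drawn \<Gamma> \<Delta>' (Diverge X Y1 P1 Y2 P2)"
    using assms(3) P1(4) P2(4) by (auto simp: consumes_def Let_def)
  then show ?thesis
    unfolding solvable_def strong_solution_single using P1 P2 assms(4-)
    by (intro exI[of _ "Diverge X Y1 P1 Y2 P2"]) (simp add: add.commute)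
qed

text \<open>The program is \<open>PUSH Y s U\<close>, then \<open>P1\<close>, then
  \<open>POP V\<close>, then \<open>P2\<close>. The push stores \<open>x + Y\<close> and continues
  with \<open>s + U\<close>; \<open>P1\<close> turns this into \<open>V\<close> and, by the frame
  property, leaves the stored product alone; the pop restores \<open>x + Y\<close>, which is the
  input of \<open>P2\<close>.\<close>

lemma solvable_embedded:
  assumes "solvable N \<Gamma> (s + U) \<Delta>1 V" "solvable N \<Gamma> (x + Y) \<Delta>2 Z"
    and "consumes \<Gamma> \<Delta>' (Embedded U V Y) (\<Delta>1 + \<Delta>2)"
    and "simple_product N U" "simple_product N V" "simple_product N Y" "set_mset s \<subseteq> {1..N - 7}"
  shows "solvable N \<Gamma> (s + x) \<Delta>' Z"
proof -
  obtain P1 where P1: "labels_ok N P1" "bracketed 0 P1"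
    "outputs P1 (Some (s + U, [])) \<subseteq> {Some (V, [])}" "drawn \<Gamma> \<Delta>1 P1"
    using assms(1) by (auto simp: solvable_def strong_solution_single)
  obtain P2 where P2: "labels_ok N P2" "bracketed 0 P2"
    "outputs P2 (Some (x + Y, [])) \<subseteq> {Some (Z, [])}" "drawn \<Gamma> \<Delta>2 P2"
    using assms(2) by (auto simp: solvable_def strong_solution_single)
  define Q where "Q = seq_program P1 (Step (POP V) P2)"
  have "drawn \<Gamma> (\<Delta>1 + \<Delta>2) Q"
    unfolding Q_def using P1 P2 by (intro drawn_seq_program) auto
  moreover have "pop_partners 0 Q = {V}"
    unfolding Q_def using P1(2) by (rule pop_partners_seq_program_pop)
  ultimately have "drawn \<Gamma> \<Delta>' (Step (PUSH Y s U) Q)"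
    unfolding drawn_Step using assms(3) by (auto simp: consumes_def)
  moreover have "bracketed (Suc 0) Q"
    unfolding Q_def using bracketed_seq_program[of 0 P1 "Suc 0" "Step (POP V) P2"] P1(2) P2(2) by simp
  moreover have "outputs (Step (PUSH Y s U) Q) (Some (s + x, [])) \<subseteq> {Some (Z, [])}"
    using outputs_frame[OF P1(3), of "[x + Y]"] P2(3)
    by (fastforce simp: Q_def outputs_seq_program)
  ultimately show ?thesis
    unfolding solvable_def strong_solution_single using P1(1) P2(1) assms(4-)
    by (intro exI[of _ "Step (PUSH Y s U) Q"]) (simp add: Q_def labels_ok_seq_program)
qed

section \<open>Charges and exceptional sectors\<close>

lemma subseteq_add_mset_iff:
  "X \<subseteq># add_mset a S \<longleftrightarrow> X \<subseteq># S \<or> (\<exists>Y. Y \<subseteq># S \<and> X = add_mset a Y)"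
proof
  assume X: "X \<subseteq># add_mset a S"
  show "X \<subseteq># S \<or> (\<exists>Y. Y \<subseteq># S \<and> X = add_mset a Y)"
  proof (cases "a \<in># X")
    case True
    then obtain Y where "X = add_mset a Y" by (metis mset_add)
    then show ?thesis using X by auto
  next
    case False
    then have "X - {#a#} = X" by simp
    then show ?thesis using X by (metis add_mset_add_single subset_eq_diff_conv)
  qed
qed (auto intro: subset_mset.order_trans)

lemma subseteq_replicate_mset_iff:
  "X \<subseteq># replicate_mset n a \<longleftrightarrow> (\<exists>i\<le>n. X = replicate_mset i a)"
proof
  show "X \<subseteq># replicate_mset n a \<Longrightarrow> \<exists>i\<le>n. X = replicate_mset i a"
  proof (induction n arbitrary: X)
    case (Suc n)
    then consider "X \<subseteq># replicate_mset n a" | Y where "Y \<subseteq># replicate_mset n a" "X = add_mset a Y"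
      by (auto simp: subseteq_add_mset_iff)
    then show ?case
    proof cases
      case 1
      then show ?thesis using Suc.IH by (meson le_SucI)
    next
      case 2
      then show ?thesis using Suc.IH[of Y] by (metis Suc_le_mono replicate_mset_Suc)
    qed
  qed simp
qed (auto simp: subseteq_mset_def)

lemma fst_sum_list: "fst (sum_list xs) = sum_list (map fst xs)"
  and snd_sum_list: "snd (sum_list xs) = sum_list (map snd xs)"
  by (induction xs) auto

lemma mem_sum_list_map:
  "x \<in> sum_list (map f As) \<longleftrightarrow> (\<exists>xs. list_all2 (\<lambda>y A. y \<in> f A) xs As \<and> x = sum_list xs)"
proof (induction As arbitrary: x)
  case (Cons A As)
  show ?case
  proof
    assume "x \<in> sum_list (map f (A # As))"
    then obtain y z where "x = y + z" "y \<in> f A" "z \<in> sum_list (map f As)"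
      by (auto elim: set_plus_elim)
    then show "\<exists>xs. list_all2 (\<lambda>y A. y \<in> f A) xs (A # As) \<and> x = sum_list xs"
      using Cons.IH[of z] by (metis list_all2_Cons sum_list.Cons)
  next
    assume "\<exists>xs. list_all2 (\<lambda>y A. y \<in> f A) xs (A # As) \<and> x = sum_list xs"
    then obtain z zs where "x = z + sum_list zs" "z \<in> f A" "list_all2 (\<lambda>y A. y \<in> f A) zs As"
      by (auto simp: list_all2_Cons2)
    moreover have "sum_list zs \<in> sum_list (map f As)"
      using calculation Cons.IH by blast
    ultimately show "x \<in> sum_list (map f (A # As))"
      by (simp add: set_plus_intro)
  qed
qed simp

lemma mem_sum_list_replicate:
  "x \<in> sum_list (replicate n X) \<longleftrightarrow> (\<exists>xs. length xs = n \<and> set xs \<subseteq> X \<and> x = sum_list xs)"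
proof -
  have "list_all2 (\<lambda>y A. y \<in> X) xs (replicate n ()) \<longleftrightarrow> length xs = n \<and> set xs \<subseteq> X" for xs
    by (auto simp: list_all2_conv_all_nth in_set_conv_nth subset_iff)
  then show ?thesis
    using mem_sum_list_map[of x "\<lambda>_. X" "replicate n ()"] by (simp add: map_replicate_const)
qed

lemma replicate_mset_add: "replicate_mset (m + n) a = replicate_mset m a + replicate_mset n a"
  by (induction m) auto

lemma sum_list_map_eq_zero:
  "(\<And>x. x \<in> set xs \<Longrightarrow> f x = 0) \<Longrightarrow> sum_list (map f xs) = (0::'a::comm_monoid_add)"
  by (induction xs) auto

lemma mem_sum_list_mset: "a \<in># sum_list (map f xs) \<longleftrightarrow> (\<exists>x\<in>set xs. a \<in># f x)"
  by (induction xs) auto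

lemma sum_list_eq_zero: "(\<And>x. x \<in> set xs \<Longrightarrow> x = 0) \<Longrightarrow> sum_list xs = (0::'a::comm_monoid_add)"
  by (induction xs) auto

lemma sum_list_eq_replicate_mset:
  "(\<And>x. x \<in> set xs \<Longrightarrow> x = {#a#}) \<Longrightarrow> sum_list xs = replicate_mset (length xs) a"
  by (induction xs) auto

lemma sum_list_member_subset: "a \<in> set xs \<Longrightarrow> a \<subseteq># (sum_list xs :: 'a multiset)"
  by (induction xs) (auto intro: subset_mset.order_trans)

context phase_space
begin

lemma sem_tensor_list: "sem (tensor_list As) = orth (orth (sum_list (map sem As)))"
proof (induction As rule: tensor_list.induct)
  case (3 A B As)
  then show ?case by (simp add: orth_closure_add_right)
qed simp_all

lemma sem_tensor_power: "sem (tensor_power A n) = orth (orth (sum_list (replicate n (sem A))))"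
  by (simp add: tensor_power_def sem_tensor_list)

lemma orth_add_mem: "\<sigma> \<in> orth (X + Y) \<longleftrightarrow> (\<forall>x\<in>X. \<forall>y\<in>Y. x + y + \<sigma> \<in> pole)"
  by (fastforce simp: orth_iff set_plus_def)

lemma orth_replicate:
  "z \<in> orth (sum_list (replicate k X)) \<longleftrightarrow> (\<forall>xs. length xs = k \<and> set xs \<subseteq> X \<longrightarrow> sum_list xs + z \<in> pole)"
  unfolding orth_iff Ball_def mem_sum_list_replicate by blast

lemma orth_replicate_add:
  "z \<in> orth (sum_list (replicate k X) + Y) \<longleftrightarrow>
     (\<forall>xs y. length xs = k \<and> set xs \<subseteq> X \<and> y \<in> Y \<longrightarrow> sum_list xs + y + z \<in> pole)"
  unfolding orth_add_mem Ball_def mem_sum_list_replicate by blast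

lemma mem_sem_limp: "f \<in> sem (A \<multimap> B) \<longleftrightarrow> (\<forall>a\<in>sem A. a + f \<in> sem B)"
proof -
  have "f \<in> sem (A \<multimap> B) \<longleftrightarrow> (\<forall>a\<in>sem A. a + f \<in> orth (orth (sem B)))"
    by (simp only: sem.simps orth_add_iff)
  then show ?thesis by simp
qed

text \<open>The transposed view of an implication: it carries tests of the conclusion to tests of
  the premise. It is preferred for \<open>E\<close>, whose tests are known explicitly while its
  elements are not.\<close>

lemma mem_sem_limp': "f \<in> sem (A \<multimap> B) \<longleftrightarrow> (\<forall>w\<in>orth (sem B). w + f \<in> orth (sem A))"
  by (simp only: sem.simps add.commute[of "sem A"] orth_add_iff)

lemma sum_mset_mem:
  "(\<And>x. x \<in># M \<Longrightarrow> g x \<in> f x) \<Longrightarrow> (\<Sum>x\<in>#M. g x) \<in> (\<Sum>x\<in>#M. f x)"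
  by (induction M) (auto intro: set_plus_intro)

lemma ante_image: "ante (image_mset f M) = (\<Sum>x\<in>#M. sem (f x))"
  by (simp add: ante_def image_mset.compositionality comp_def)

lemma multiplicative_tensor_list:
  "As \<noteq> [] \<Longrightarrow> (\<And>A. A \<in> set As \<Longrightarrow> multiplicative A) \<Longrightarrow> multiplicative (tensor_list As)"
  by (induction As rule: tensor_list.induct) auto

lemma multiplicative_tensor_power: "n > 0 \<Longrightarrow> multiplicative A \<Longrightarrow> multiplicative (tensor_power A n)"
  unfolding tensor_power_def by (rule multiplicative_tensor_list) auto

text \<open>\<open>N > 0\<close> and \<open>X \<noteq> []\<close> prevent an empty tensor product,
  which would be the unit \<open>\<one>\<close> and is not multiplicative.\<close>

lemma multiplicative_E: "N > 0 \<Longrightarrow> X \<noteq> [] \<Longrightarrow> multiplicative (E N X)"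
  by (auto simp: E_def D_prod_def D_lit_def H1_def C00_def H00_def
      intro!: multiplicative_tensor_power multiplicative_tensor_list)

end

text \<open>
  \<open>SC\<close>, \<open>SH\<close>, \<open>SB\<close> are generic elements of \<open>C00\<close>, \<open>H00\<close>, \<open>\<bottom>\<close>; \<open>SU k\<close> stands for \<open>\<bottom>\<^sup>k\<close> on the right of the
  turnstile and \<open>SE t\<close> for \<open>E_t\<close> (with the literal \<open>p\<close> added) on the right; \<open>SGC\<close> and \<open>SG k\<close> are
  generic elements of the premises \<open>H00\<^sup>2 \<multimap> \<bottom>\<^sup>3\<close> and \<open>H1 \<multimap> \<bottom>\<^sup>k\<close> of \<open>C00\<close> and \<open>D\<close>.
  A resource consists of the number of elements of \<open>H1\<close>, the literals, the formulas of \<open>\<Delta>\<close>, and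
  the number of marks \<open>\<tau>\<close> for derelictions; resources have charge \<open>0\<close>.
\<close>

datatype sector = SC | SH | SB | SU nat | SGC | SG nat | SE product

type_synonym resource = "nat \<times> product \<times> product nform multiset \<times> nat"
type_synonym point = "sector multiset \<times> resource"

text \<open>The charge of a generator is written as \<open>charge_N x * N + charge_1 x\<close>.\<close>

fun charge_N :: "sector \<Rightarrow> int" where
  "charge_N SC = -2" | "charge_N SH = -1" | "charge_N SB = 0" | "charge_N (SU k) = 0"
| "charge_N SGC = 2" | "charge_N (SG k) = 0" | "charge_N (SE t) = 3"

fun charge_1 :: "sector \<Rightarrow> int" where
  "charge_1 SC = 0" | "charge_1 SH = 0" | "charge_1 SB = 1" | "charge_1 (SU k) = 1 - int k"
| "charge_1 SGC = 3" | "charge_1 (SG k) = int k" | "charge_1 (SE t) = 1"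

definition total_N :: "sector multiset \<Rightarrow> int" where "total_N s = (\<Sum>x\<in>#s. charge_N x)"
definition total_1 :: "sector multiset \<Rightarrow> int" where "total_1 s = (\<Sum>x\<in>#s. charge_1 x)"

lemma total_simps [simp]:
  "total_N {#} = 0" "total_N (add_mset x s) = charge_N x + total_N s" "total_N (s + t) = total_N s + total_N t"
  "total_N (replicate_mset n x) = int n * charge_N x"
  "total_1 {#} = 0" "total_1 (add_mset x s) = charge_1 x + total_1 s" "total_1 (s + t) = total_1 s + total_1 t"
  "total_1 (replicate_mset n x) = int n * charge_1 x"
  by (simp_all add: total_N_def total_1_def)

definition has_charge :: "nat \<Rightarrow> int \<Rightarrow> sector multiset \<Rightarrow> bool" where
  "has_charge N c s \<longleftrightarrow> 9 * int N dvd total_N s * int N + total_1 s - c"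

lemma has_charge_add:
  assumes "has_charge N c s" "has_charge N d t" shows "has_charge N (c + d) (s + t)"
proof -
  have "total_N (s + t) * int N + total_1 (s + t) - (c + d)
    = (total_N s * int N + total_1 s - c) + (total_N t * int N + total_1 t - d)"
    by (simp add: algebra_simps)
  then show ?thesis
    using assms unfolding has_charge_def by (metis dvd_add)
qed

lemma has_charge_cancel:
  assumes "has_charge N c (s + t)" "has_charge N d t" shows "has_charge N (c - d) s"
proof -
  have "total_N s * int N + total_1 s - (c - d)
    = (total_N (s + t) * int N + total_1 (s + t) - c) - (total_N t * int N + total_1 t - d)"
    by (simp add: algebra_simps)
  then show ?thesis
    using assms unfolding has_charge_def by (metis dvd_diff)
qed

lemma has_charge_total: "has_charge N (total_N s * int N + total_1 s) s"
  by (simp add: has_charge_def)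

lemma has_charge_cong:
  assumes "has_charge N c s" "d = c + 9 * int N * z" shows "has_charge N d s"
proof -
  have "total_N s * int N + total_1 s - d = (total_N s * int N + total_1 s - c) - 9 * int N * z"
    using assms(2) by simp
  then show ?thesis
    using assms(1) unfolding has_charge_def by (metis dvd_diff dvd_triv_left)
qed

lemma has_charge_sum_list:
  "(\<And>s. s \<in> set xs \<Longrightarrow> has_charge N c s) \<Longrightarrow> has_charge N (int (length xs) * c) (sum_list xs)"
proof (induction xs)
  case Nil
  show ?case by (simp add: has_charge_def)
next
  case (Cons x xs)
  then have "has_charge N (c + int (length xs) * c) (x + sum_list xs)"
    by (intro has_charge_add) auto
  then show ?case by (simp add: algebra_simps)
qed

text \<open>There are two ways to exploit a charge. If its integer value is close to the expected
  one, the congruence is an equality; this suits sectors with many copies of \<open>SB\<close>. If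
  only the unit part is close, \<open>has_charge_split\<close> compares unit parts modulo
  \<open>N\<close> and the rest modulo \<open>9\<close>; this suits sectors with many multiples of
  \<open>N\<close>.\<close>

lemma has_charge_small:
  assumes "has_charge N c s" "\<bar>total_N s * int N + total_1 s - c\<bar> < 9 * int N"
  shows "total_N s * int N + total_1 s = c"
  using assms dvd_imp_le_int[of "total_N s * int N + total_1 s - c" "9 * int N"]
  unfolding has_charge_def by fastforce

lemma has_charge_split:
  assumes "has_charge N (a * int N + b) s" "\<bar>total_1 s - b\<bar> < int N"
  shows "total_1 s = b" "9 dvd total_N s - a"
proof -
  have *: "9 * int N dvd (total_N s - a) * int N + (total_1 s - b)"
    using assms(1) by (simp add: has_charge_def algebra_simps)
  then have "int N dvd (total_N s - a) * int N + (total_1 s - b)"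
    by (metis dvd_mult_right)
  then have "int N dvd total_1 s - b"
    by (simp add: dvd_add_right_iff)
  then show b: "total_1 s = b"
    using assms(2) dvd_imp_le_int[of "total_1 s - b" "int N"] by fastforce
  have "int N \<noteq> 0" using assms(2) by auto
  then show "9 dvd total_N s - a"
    using * b by (simp add: mult.commute[of _ "int N"])
qed

text \<open>The sectors on which \<open>admissible\<close> says something, stated inductively to
  allow case analysis. All have charge \<open>1\<close>. Apart from \<open>red'\<close>, each
  combines generic elements of a formula and of its tests. Naming \<open>N + 2\<close> and
  \<open>N + 1\<close> by \<open>n\<close> keeps \<open>replicate_mset\<close> from being
  unfolded.\<close>

inductive exceptional :: "nat \<Rightarrow> sector multiset \<Rightarrow> bool" for N where
  goal: "exceptional N (add_mset (SE t) (replicate_mset 6 SC))"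
| unit: "exceptional N {#SB#}"
| bots: "2 \<le> k \<Longrightarrow> k \<le> N \<Longrightarrow> exceptional N (add_mset (SU k) (replicate_mset k SB))"
| red: "n = N + 2 \<Longrightarrow> exceptional N (add_mset SH (add_mset (SU 2) (replicate_mset n SB)))"
| red': "n = N + 1 \<Longrightarrow> exceptional N (add_mset SH (replicate_mset n SB))"
| gc2: "exceptional N {#SGC, SH, SH, SU 3#}"
| gc1: "exceptional N {#SGC, SC, SU 3#}"
| h1: "exceptional N (add_mset (SU N) (replicate_mset 4 SC))"
| lit: "5 \<le> k \<Longrightarrow> k \<le> N - 3 \<Longrightarrow> exceptional N {#SG k, SU k#}"

lemma subseteq_add_replicateE:
  assumes "X \<subseteq># add_mset a (replicate_mset n b)"
  obtains i j where "i \<le> n" "j \<le> 1" "X = replicate_mset j a + replicate_mset i b"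
proof -
  consider "X \<subseteq># replicate_mset n b" | Y where "Y \<subseteq># replicate_mset n b" "X = add_mset a Y"
    using assms by (auto simp: subseteq_add_mset_iff)
  then show thesis
  proof cases
    case 1
    then show thesis using that[of _ 0] by (auto simp: subseteq_replicate_mset_iff)
  next
    case 2
    then show thesis using that[of _ 1] by (auto simp: subseteq_replicate_mset_iff)
  qed
qed

lemma subseteq_add_add_replicateE:
  assumes "X \<subseteq># add_mset c (add_mset a (replicate_mset n b))"
  obtains i j l where "i \<le> n" "j \<le> 1" "l \<le> 1"
    "X = replicate_mset l c + replicate_mset j a + replicate_mset i b"
proof -
  consider "X \<subseteq># add_mset a (replicate_mset n b)"
    | Y where "Y \<subseteq># add_mset a (replicate_mset n b)" "X = add_mset c Y"
    using assms by (auto simp: subseteq_add_mset_iff)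
  then show thesis
  proof cases
    case 1
    then show thesis using that[of _ _ 0] by (auto elim!: subseteq_add_replicateE)
  next
    case 2
    then show thesis using that[of _ _ 1] by (auto elim!: subseteq_add_replicateE)
  qed
qed

text \<open>Two copies of \<open>SH\<close> have the same charge as \<open>SC\<close>, so charges
  cannot separate them; they do exclude every other part of an exceptional sector.\<close>

lemma exceptional_C:
  assumes "exceptional N s" "X \<subseteq># s" "has_charge N (-2 * int N) X" "N \<ge> 8"
  shows "X = {#SC#} \<or> X = {#SH, SH#}"
  using assms(1)
proof cases
  case (goal t)
  then obtain i j where X: "i \<le> 6" "j \<le> 1" "X = replicate_mset j (SE t) + replicate_mset i SC"
    using assms(2) by (auto elim: subseteq_add_replicateE)
  have "total_1 X = 0" "9 dvd total_N X - (-2)"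
    using has_charge_split[of N "-2" 0 X] assms(3,4) X by auto
  then have "j = 0" "9 dvd 2 - int i * 2" using X by simp_all
  then have "i = 1" using X(1) by presburger
  then show ?thesis using X \<open>j = 0\<close> by simp
next
  case unit
  then have "X = {#} \<or> X = {#SB#}" using assms(2) by (auto simp: subseteq_add_mset_iff)
  then show ?thesis using assms(4) has_charge_small[OF assms(3)] by auto
next
  case (bots k)
  then obtain i j where X: "i \<le> k" "j \<le> 1" "X = replicate_mset j (SU k) + replicate_mset i SB"
    using assms(2) by (auto elim: subseteq_add_replicateE)
  from \<open>j \<le> 1\<close> have "j = 0 \<or> j = 1" by auto
  then show ?thesis using bots X assms(4) has_charge_small[OF assms(3)] by auto
next
  case (red n)
  from assms(2)[unfolded red(1)]
  obtain i j l where X: "i \<le> n" "j \<le> 1" "l \<le> 1"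
    "X = replicate_mset l SH + replicate_mset j (SU 2) + replicate_mset i SB"
    by (rule subseteq_add_add_replicateE)
  then have "j = 0 \<or> j = 1" "l = 0 \<or> l = 1" by auto
  then show ?thesis using red X assms(4) has_charge_small[OF assms(3)] by auto
next
  case (red' n)
  from assms(2)[unfolded red'(1)]
  obtain i j where X: "i \<le> n" "j \<le> 1" "X = replicate_mset j SH + replicate_mset i SB"
    by (rule subseteq_add_replicateE)
  then have "j = 0 \<or> j = 1" by auto
  then show ?thesis using red' X assms(4) has_charge_small[OF assms(3)] by auto
next
  case gc2
  then have "X \<subseteq># add_mset SGC (add_mset (SU 3) (replicate_mset 2 SH))"
    using assms(2) by (simp add: numeral_2_eq_2 add_mset_commute)
  then obtain i j l where X: "i \<le> 2" "j \<le> 1" "l \<le> 1"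
    "X = replicate_mset l SGC + replicate_mset j (SU 3) + replicate_mset i SH"
    by (rule subseteq_add_add_replicateE)
  then have jl: "j = 0 \<or> j = 1" "l = 0 \<or> l = 1" by auto
  have "total_1 X = 0" "9 dvd total_N X - (-2)"
    using has_charge_split[of N "-2" 0 X] assms(3,4) X jl by auto
  then have 0: "l = 0" "j = 0" and "9 dvd 2 - int i" using X(4) jl by auto
  then have "i = 2" using X(1) by presburger
  then show ?thesis using X(4) 0 by (simp add: numeral_2_eq_2)
next
  case gc1
  then have "X \<subseteq># add_mset SGC (add_mset (SU 3) (replicate_mset 1 SC))"
    using assms(2) by (simp add: add_mset_commute)
  then obtain i j l where X: "i \<le> 1" "j \<le> 1" "l \<le> 1"
    "X = replicate_mset l SGC + replicate_mset j (SU 3) + replicate_mset i SC"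
    by (rule subseteq_add_add_replicateE)
  then have ijl: "i = 0 \<or> i = 1" "j = 0 \<or> j = 1" "l = 0 \<or> l = 1" by auto
  have "total_1 X = 0" "9 dvd total_N X - (-2)"
    using has_charge_split[of N "-2" 0 X] assms(3,4) X ijl by auto
  then show ?thesis using X(4) ijl by auto
next
  case h1
  then obtain i j where X: "i \<le> 4" "j \<le> 1" "X = replicate_mset j (SU N) + replicate_mset i SC"
    using assms(2) by (auto elim: subseteq_add_replicateE)
  then have "j = 0 \<or> j = 1" by auto
  then have "total_1 X = 0" "9 dvd total_N X - (-2)"
    using has_charge_split[of N "-2" 0 X] assms(3,4) X by auto
  then have "j = 0" "9 dvd 2 - int i * 2" using X assms(4) by auto
  then have "i = 1" using X(1) by presburger
  then show ?thesis using X \<open>j = 0\<close> by simp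
next
  case (lit k)
  then obtain i j where X: "i \<le> 1" "j \<le> 1" "X = replicate_mset j (SG k) + replicate_mset i (SU k)"
    using assms(2) subseteq_add_replicateE[of X "SG k" 1 "SU k"] by auto
  then have "i = 0 \<or> i = 1" "j = 0 \<or> j = 1" by auto
  moreover have "int k \<le> int N - 3" using lit assms(4) by linarith
  ultimately show ?thesis using lit X assms(4) has_charge_small[OF assms(3)] by auto
qed

text \<open>Four factors of this charge need four occurrences of \<open>SC\<close> or
  \<open>SH\<close>. Only \<open>goal\<close> and \<open>h1\<close> have so many, and these contain
  no \<open>SH\<close>, which settles the ambiguity left by \<open>exceptional_C\<close>.\<close>

lemma exceptional_C_list:
  assumes "exceptional N s" "sum_list cs \<subseteq># s" "\<And>c. c \<in> set cs \<Longrightarrow> has_charge N (-2 * int N) c"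
    and "length cs \<ge> 4" "N \<ge> 8"
  shows "\<forall>c\<in>set cs. c = {#SC#}" "(\<exists>t. s = add_mset (SE t) (replicate_mset 6 SC)) \<or> s = add_mset (SU N) (replicate_mset 4 SC)"
proof -
  have c: "c = {#SC#} \<or> c = {#SH, SH#}" if "c \<in> set cs" for c
    using exceptional_C[OF assms(1) _ assms(3)[OF that] assms(5)] sum_list_member_subset[OF that] assms(2)
    by (meson subset_mset.order_trans)
  have "length cs \<le> count (sum_list cs) SC + count (sum_list cs) SH"
    using c
  proof (induction cs)
    case (Cons c cs)
    have "length cs \<le> count (sum_list cs) SC + count (sum_list cs) SH"
      by (rule Cons.IH) (simp add: Cons.prems)
    moreover have "c = {#SC#} \<or> c = {#SH, SH#}"
      using Cons.prems[of c] by simp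
    ultimately show ?case by auto
  qed simp
  then have 4: "count s SC + count s SH \<ge> 4"
    using assms(2,4) mset_subset_eq_count[OF assms(2), of SC] mset_subset_eq_count[OF assms(2), of SH]
    by linarith
  show s: "(\<exists>t. s = add_mset (SE t) (replicate_mset 6 SC)) \<or> s = add_mset (SU N) (replicate_mset 4 SC)"
    using assms(1) 4 by cases auto
  show "\<forall>c\<in>set cs. c = {#SC#}"
  proof
    fix c assume "c \<in> set cs"
    then have "c \<subseteq># s" "c = {#SC#} \<or> c = {#SH, SH#}"
      using c sum_list_member_subset assms(2) by (auto intro: subset_mset.order_trans)
    then show "c = {#SC#}"
      using s by (auto dest: mset_subset_eqD[of _ _ SH])
  qed
qed

section \<open>The phase space of strong solutions\<close>

locale encoding =
  fixes N p :: nat and \<Gamma> :: "product nform multiset"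
  assumes N8: "N \<ge> 8"
begin

text \<open>The goal \<open>t\<close> stands for the conclusion \<open>E\<close> of \<open>p\<close>
  and \<open>t\<close>; the empty goal is the conclusion of part (b) and requires exactly what (b)
  asserts, with \<open>i\<close> counting marks. For other goals \<open>i\<close> is free, and the
  count of \<open>p\<close> is the first claim of (a).\<close>

definition provable :: "product \<Rightarrow> product \<times> product nform multiset \<times> nat \<Rightarrow> bool" where
  "provable t r = (case r of (W, \<Delta>, i) \<Rightarrow>
     if t = {#} then W = {#p#} \<and> \<Delta> = {#} \<and> i = 0
     else set_mset W \<subseteq> {1..N - 7} \<and> count W p = 1 \<and> solvable N \<Gamma> (W - {#p#}) \<Delta> t)"

text \<open>As \<open>H1 \<turnstile> D_lit N m\<close> is derivable for every \<open>m\<close>, an element of \<open>H1\<close> can stand for any literal.\<close>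

definition wild :: resource where "wild = (1, 0)"

definition lits :: "product \<Rightarrow> resource" where "lits W = (0, W, 0)"

text \<open>
  Sectors that are not listed are junk: every point of charge \<open>1\<close> over them lies in the pole.
  The sector with \<open>SH\<close> and \<open>N + 1\<close> copies of \<open>SB\<close> has charge \<open>1\<close> and must be excluded altogether,
  because together with one more \<open>SB\<close> and \<open>SU 2\<close> it is the sector of \<open>H00\<close>, where the resource
  has to vanish.
\<close>

definition admissible :: "sector multiset \<Rightarrow> resource \<Rightarrow> bool" where
  "admissible s q \<longleftrightarrow>
     (\<forall>t r. s = add_mset (SE t) (replicate_mset 6 SC) \<longrightarrow> q = (0, r) \<longrightarrow> provable t r) \<and>
     (s = {#SB#} \<longrightarrow> q = 0) \<and>
     (\<forall>k. 2 \<le> k \<longrightarrow> k \<le> N \<longrightarrow> s = add_mset (SU k) (replicate_mset k SB) \<longrightarrow> q = 0) \<and>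
     (\<forall>n. n = N + 2 \<longrightarrow> s = add_mset SH (add_mset (SU 2) (replicate_mset n SB)) \<longrightarrow> q = 0) \<and>
     (\<forall>n. n = N + 1 \<longrightarrow> s \<noteq> add_mset SH (replicate_mset n SB)) \<and>
     (s = {#SGC, SH, SH, SU 3#} \<longrightarrow> q = 0) \<and>
     (s = {#SGC, SC, SU 3#} \<longrightarrow> q = 0) \<and>
     (s = add_mset (SU N) (replicate_mset 4 SC) \<longrightarrow> q = wild) \<and>
     (\<forall>k. 5 \<le> k \<longrightarrow> k \<le> N - 3 \<longrightarrow> s = {#SG k, SU k#} \<longrightarrow> q = wild \<or> q = lits {#k - 4#})"

text \<open>Four counts that separate the different shapes of exceptional sectors, so that
  distinctness reduces to arithmetic.\<close>

definition signature :: "sector multiset \<Rightarrow> nat \<times> nat \<times> nat \<times> nat" where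
  "signature s = (count s SC, count s SH, count s SB, count s SGC)"

lemma admissible_not_exceptional: "\<not> exceptional N s \<Longrightarrow> admissible s q"
  unfolding admissible_def by (blast intro: exceptional.intros)

lemma signature_cong: "s = t \<Longrightarrow> signature s = signature t"
  by simp

lemma admissible_goal:
  assumes "\<And>r. q = (0, r) \<Longrightarrow> provable t r"
  shows "admissible (add_mset (SE t) (replicate_mset 6 SC)) q"
  unfolding admissible_def
  by (intro conjI allI impI notI; (use assms in simp; fail)?; drule signature_cong; simp add: signature_def)

lemma admissible_unit: "admissible {#SB#} 0"
  unfolding admissible_def
  by (intro conjI allI impI notI; (simp; fail)?; drule signature_cong; simp add: signature_def)

lemma admissible_bots: "2 \<le> k \<Longrightarrow> admissible (add_mset (SU k) (replicate_mset k SB)) 0"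
  unfolding admissible_def
  by (intro conjI allI impI notI; (simp; fail)?; drule signature_cong; simp add: signature_def)

lemma admissible_red:
  "n = N + 2 \<Longrightarrow> admissible (add_mset SH (add_mset (SU 2) (replicate_mset n SB))) 0"
  unfolding admissible_def
  by (intro conjI allI impI notI; (simp; fail)?; drule signature_cong; simp add: signature_def)

lemma admissible_gc2: "admissible {#SGC, SH, SH, SU 3#} 0"
  unfolding admissible_def
  by (intro conjI allI impI notI; (simp; fail)?; drule signature_cong; simp add: signature_def)

lemma admissible_gc1: "admissible {#SGC, SC, SU 3#} 0"
  unfolding admissible_def
  by (intro conjI allI impI notI; (simp; fail)?; drule signature_cong; simp add: signature_def)

lemma admissible_h1: "admissible (add_mset (SU N) (replicate_mset 4 SC)) wild"
  unfolding admissible_def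
  by (intro conjI allI impI notI; (simp; fail)?; drule signature_cong; simp add: signature_def)

lemma admissible_lit:
  assumes "q = wild \<or> q = lits {#k - 4#}"
  shows "admissible {#SG k, SU k#} q"
proof -
  have "j = k" if "{#SG k, SU k#} = {#SG j, SU j#}" for j
    using arg_cong[OF that, of "\<lambda>s. SG k \<in># s"] by simp
  then have *: "{#SG k, SU k#} = {#SG j, SU j#} \<Longrightarrow> q = wild \<or> q = lits {#j - 4#}" for j
    using assms by blast
  show ?thesis
    unfolding admissible_def
    by (intro conjI allI impI notI; (rule *, assumption)?; drule signature_cong; simp add: signature_def)
qed

section \<open>The pole and the tests of the powers of \<open>\<bottom>\<close>\<close>

definition cpole :: "point set" where
  "cpole = {x. has_charge N 1 (fst x) \<and> admissible (fst x) (snd x)}"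

sublocale phase_space cpole .

lemma cpole_charge: "x \<in> cpole \<Longrightarrow> has_charge N 1 (fst x)"
  and cpole_admissible: "x \<in> cpole \<Longrightarrow> admissible (fst x) (snd x)"
  by (simp_all add: cpole_def)

lemma cpoleI:
  assumes "has_charge N 1 (fst x)" "exceptional N (fst x) \<Longrightarrow> admissible (fst x) (snd x)"
  shows "x \<in> cpole"
  unfolding cpole_def mem_Collect_eq using assms admissible_not_exceptional by metis

definition bottoms :: "nat \<Rightarrow> point set" where
  "bottoms k = orth (sum_list (replicate k cpole))"

lemma orth_sem_bots: "orth (sem (tensor_power \<bottom> k)) = bottoms k"
  by (simp add: sem_tensor_power bottoms_def)

lemma mem_bottoms:
  "z \<in> bottoms k \<longleftrightarrow> (\<forall>xs. length xs = k \<and> set xs \<subseteq> cpole \<longrightarrow> sum_list xs + z \<in> cpole)"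
  unfolding bottoms_def by (rule orth_replicate)

lemma unit_cpole: "({#SB#}, 0) \<in> cpole"
  using admissible_unit by (simp add: cpole_def has_charge_def)

lemma sum_list_unit: "sum_list (replicate k ({#SB#}, 0::resource)) = (replicate_mset k SB, 0)"
  by (induction k) (auto simp: zero_prod_def)

lemma bottoms_bots: "z \<in> bottoms k \<Longrightarrow> (replicate_mset k SB + fst z, snd z) \<in> cpole"
  unfolding mem_bottoms
  by (drule spec[of _ "replicate k ({#SB#}, 0)"]) (use unit_cpole in \<open>auto simp: sum_list_unit plus_prod_def\<close>)

lemma bottoms_charge:
  assumes "z \<in> bottoms k" shows "has_charge N (1 - int k) (fst z)"
proof (rule has_charge_cancel)
  show "has_charge N 1 (fst z + replicate_mset k SB)"
    using cpole_charge[OF bottoms_bots[OF assms]] by (simp add: add.commute)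
  show "has_charge N (int k) (replicate_mset k SB)"
    using has_charge_total[of N "replicate_mset k SB"] by simp
qed

lemma bottoms_zero:
  assumes "z \<in> bottoms k" "fst z = {#SU k#}" "2 \<le> k" "k \<le> N" shows "snd z = 0"
  using cpole_admissible[OF bottoms_bots[OF assms(1)]] assms(2-) by (simp add: admissible_def)

lemma cpole_bots:
  assumes "x \<in> cpole" "fst x \<subseteq># replicate_mset n SB" "n \<le> N + 2"
  shows "snd x = 0"
proof -
  obtain i where i: "i \<le> n" "fst x = replicate_mset i SB"
    using assms(2) by (auto simp: subseteq_replicate_mset_iff)
  then have "i = 1"
    using has_charge_small[OF cpole_charge[OF assms(1)]] assms(3) N8 by simp
  then show ?thesis
    using cpole_admissible[OF assms(1)] i by (simp add: admissible_def)
qed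

lemma cpole_list_bots:
  assumes "set xs \<subseteq> cpole" "sum_list (map fst xs) = replicate_mset n SB" "n \<le> N + 2"
  shows "sum_list (map snd xs) = 0"
proof (rule sum_list_eq_zero)
  fix q assume "q \<in> set (map snd xs)"
  then obtain x where x: "x \<in> set xs" "q = snd x" by auto
  then have "fst x \<subseteq># replicate_mset n SB"
    using sum_list_member_subset[of "fst x" "map fst xs"] assms(2) by simp
  then show "q = 0" using cpole_bots[of x n] x assms by auto
qed

lemma cpole_list_charge:
  assumes "set xs \<subseteq> cpole" shows "has_charge N (int (length xs)) (sum_list (map fst xs))"
  using has_charge_sum_list[of "map fst xs" N 1] assms cpole_charge by fastforce

text \<open>
  The powers of \<open>\<bottom>\<close> that occur as conclusions of implications: \<open>2\<close> in \<open>H00\<close>, \<open>3\<close> in \<open>C00\<close>,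
  \<open>N\<close> in \<open>H1\<close>, and \<open>m + 4\<close> in \<open>D_lit N m\<close>.
\<close>

definition exponents :: "nat set" where "exponents = {2, 3, N} \<union> {5..N - 3}"

text \<open>The \<open>k\<close> points of the pole have to share what \<open>SU k\<close> leaves of
  an exceptional sector. In \<open>bots\<close> each of them is then a single \<open>SB\<close> with
  resource \<open>0\<close>. In \<open>gc2\<close>, \<open>gc1\<close>, \<open>h1\<close> and
  \<open>lit\<close> not even one point of charge \<open>1\<close> fits, and \<open>red\<close> is
  excluded by the condition on \<open>red'\<close>.\<close>

lemma tester_bottoms:
  assumes k: "k \<in> exponents" shows "({#SU k#}, 0) \<in> bottoms k"
  unfolding mem_bottoms
proof (intro allI impI)
  fix xs assume xs: "length xs = k \<and> set xs \<subseteq> cpole"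
  have k2: "2 \<le> k" "k \<le> N" using k N8 by (auto simp: exponents_def)
  define s q where "s = sum_list (map fst xs)" and "q = sum_list (map snd xs)"
  have sub: "fst x \<subseteq># s" if "x \<in> set xs" for x
    using that sum_list_member_subset[of "fst x" "map fst xs"] by (simp add: s_def)
  obtain x0 where x0: "x0 \<in> set xs" "x0 \<in> cpole"
    using xs k2 by (metis hd_in_set list.size(3) not_numeral_le_zero subsetD)
  note c0 = cpole_charge[OF x0(2)]
  have "has_charge N (int k + (1 - int k)) (s + {#SU k#})"
    using cpole_list_charge[of xs] xs has_charge_total[of N "{#SU k#}"]
    by (intro has_charge_add) (auto simp: s_def)
  then have ch: "has_charge N 1 (add_mset (SU k) s)" by simp
  have "admissible (add_mset (SU k) s) q" if "exceptional N (add_mset (SU k) s)"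
  proof -
    have mem: "SU k \<in># add_mset (SU k) s" by simp
    from that show ?thesis
    proof cases
      case (goal t)
      then show ?thesis using mem by simp
    next
      case unit
      then show ?thesis using mem by simp
    next
      case (bots j)
      then have "j = k" using mem by auto
      then have s: "s = replicate_mset k SB" using bots by simp
      then have "q = 0" using cpole_list_bots[of xs k] xs k2 by (simp add: s_def q_def)
      then show ?thesis using s admissible_bots k2 by simp
    next
      case (red n)
      have "k = 2" using mem unfolding red(1) by (simp split: if_splits)
      then have s: "s = add_mset SH (replicate_mset n SB)" using red(1) by (simp add: add_mset_commute)
      \<comment> \<open>The point that contains \<open>SH\<close> needs \<open>N + 1\<close> copies
        of \<open>SB\<close> to reach charge \<open>1\<close>; this is precisely the sector kept out
        of the pole.\<close>
      then have "SH \<in># sum_list (map fst xs)" by (simp add: s_def)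
      then obtain x where x: "x \<in> set xs" "SH \<in># fst x"
        by (auto simp: mem_sum_list_mset)
      then have "fst x \<subseteq># add_mset SH (replicate_mset n SB)" using sub s by simp
      then obtain i j where ij: "i \<le> n" "j \<le> 1" "fst x = replicate_mset j SH + replicate_mset i SB"
        by (rule subseteq_add_replicateE)
      then have "j = 1" using x(2) by (cases j) (auto split: if_splits)
      have xc: "x \<in> cpole" using x xs by auto
      have "total_N (fst x) * int N + total_1 (fst x) = int i - int N"
        using ij(3) \<open>j = 1\<close> by simp
      then have "i = N + 1"
        using has_charge_small[OF cpole_charge[OF xc]] ij(1) \<open>n = N + 2\<close> N8 by linarith
      then show ?thesis
        using cpole_admissible[OF xc] ij(3) \<open>j = 1\<close> by (simp add: admissible_def)
    next
      case (red' n)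
      then show ?thesis using mem by (auto split: if_splits)
    next
      case gc2
      then have "k = 3" using mem by auto
      then have "s = add_mset SGC (replicate_mset 2 SH)"
        using gc2 by (simp add: add_mset_commute numeral_2_eq_2)
      then have "fst x0 \<subseteq># add_mset SGC (replicate_mset 2 SH)" using sub x0 by simp
      then obtain i j where ij: "i \<le> 2" "j \<le> 1" "fst x0 = replicate_mset j SGC + replicate_mset i SH"
        by (rule subseteq_add_replicateE)
      then have "j = 0 \<or> j = 1" by auto
      then have "total_1 (fst x0) = 1"
        using has_charge_split(1)[of N 0 1 "fst x0"] c0 ij(3) N8 by auto
      then show ?thesis using ij(3) \<open>j = 0 \<or> j = 1\<close> by (elim disjE) auto
    next
      case gc1
      then have "k = 3" using mem by auto
      then have "s = add_mset SGC (replicate_mset 1 SC)"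
        using gc1 by (simp add: add_mset_commute)
      then have "fst x0 \<subseteq># add_mset SGC (replicate_mset 1 SC)" using sub x0 by simp
      then obtain i j where ij: "i \<le> 1" "j \<le> 1" "fst x0 = replicate_mset j SGC + replicate_mset i SC"
        by (rule subseteq_add_replicateE)
      then have "j = 0 \<or> j = 1" by auto
      then have "total_1 (fst x0) = 1"
        using has_charge_split(1)[of N 0 1 "fst x0"] c0 ij(3) N8 by auto
      then show ?thesis using ij(3) \<open>j = 0 \<or> j = 1\<close> by (elim disjE) auto
    next
      case h1
      then have "k = N" using mem by auto
      then have "fst x0 \<subseteq># replicate_mset 4 SC" using h1 sub x0 by simp
      then obtain i where "i \<le> 4" "fst x0 = replicate_mset i SC"
        by (auto simp: subseteq_replicate_mset_iff)
      then show ?thesis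
        using has_charge_split(1)[of N 0 1 "fst x0"] c0 N8 by auto
    next
      case (lit j)
      then have j: "j = k" using mem by auto
      then have "s = {#SG k#}" using lit by (simp add: add_mset_commute)
      then have "fst x0 = {#} \<or> fst x0 = {#SG k#}"
        using sub[OF x0(1)] by (auto simp: subseteq_add_mset_iff)
      moreover have "5 \<le> int k" "int k \<le> int N - 3" using lit j N8 by auto
      ultimately show ?thesis
        using has_charge_small[OF c0] N8 by auto
    qed
  qed
  then show "sum_list xs + ({#SU k#}, 0) \<in> cpole"
    using ch by (intro cpoleI) (auto simp: s_def q_def fst_sum_list snd_sum_list)
qed

lemmas sum_list_prod = fst_sum_list snd_sum_list

subsection \<open>Interpretation of the encoded literals\<close>

lemma mem_sem_H00:
  "h \<in> sem (H00 N) \<longleftrightarrow> (\<forall>xs z. length xs = N + 2 \<and> set xs \<subseteq> cpole \<and> z \<in> bottoms 2 \<longrightarrow>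
     sum_list xs + z + h \<in> cpole)"
proof -
  have "sem (H00 N) = orth (sum_list (replicate (N + 2) cpole) + bottoms 2)"
    by (simp add: H00_def orth_sem_bots) (simp add: sem_tensor_power orth_closure_add)
  then show ?thesis by (simp only: orth_replicate_add)
qed

text \<open>An element of \<open>bottoms 2\<close> has charge \<open>-1\<close>. In
  \<open>red\<close> this forces it to be \<open>SU 2\<close>; in \<open>red'\<close> it would
  consist of copies of \<open>SB\<close>, which have positive charge; in \<open>gc2\<close> no point
  of the pole fits into the remainder.\<close>

lemma SH_mem: "({#SH#}, 0) \<in> sem (H00 N)"
  unfolding mem_sem_H00
proof (intro allI impI, elim conjE)
  fix xs z assume len: "length xs = N + 2" and xs: "set xs \<subseteq> cpole" and z: "z \<in> bottoms 2"
  define s where "s = sum_list (map fst xs)"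
  have sub: "fst x \<subseteq># s" if "x \<in> set xs" for x
    using that sum_list_member_subset[of "fst x" "map fst xs"] by (simp add: s_def)
  obtain x0 where x0: "x0 \<in> set xs" "x0 \<in> cpole"
    using xs len by (metis add_2_eq_Suc' hd_in_set list.size(3) nat.distinct(1) subsetD)
  note cz = bottoms_charge[OF z]
  have "has_charge N (int (N + 2) + (1 - int 2) + - int N) (s + fst z + {#SH#})"
    using cpole_list_charge[OF xs] len has_charge_total[of N "{#SH#}"] cz
    by (intro has_charge_add) (auto simp: s_def)
  then have ch: "has_charge N 1 (add_mset SH (s + fst z))" by simp
  have "admissible (add_mset SH (s + fst z)) (sum_list (map snd xs) + snd z)"
    if "exceptional N (add_mset SH (s + fst z))"
  proof -
    have mem: "SH \<in># add_mset SH (s + fst z)" by simp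
    from that show ?thesis
    proof cases
      case (red n)
      then have eq: "s + fst z = add_mset (SU 2) (replicate_mset n SB)"
        by simp
      then have "fst z \<subseteq># add_mset (SU 2) (replicate_mset n SB)"
        by (metis mset_subset_eq_add_right)
      then obtain i j where ij: "i \<le> n" "j \<le> 1" "fst z = replicate_mset j (SU 2) + replicate_mset i SB"
        by (rule subseteq_add_replicateE)
      then have "j = 0 \<or> j = 1" by auto
      then have "j = 1" "i = 0"
        using has_charge_small[OF cz] ij(1,3) \<open>n = N + 2\<close> N8 by auto
      then have fz: "fst z = {#SU 2#}" using ij(3) by simp
      then have "snd z = 0" using bottoms_zero[OF z] N8 by simp
      have s: "s = replicate_mset n SB" using eq fz by simp
      then have "sum_list (map snd xs) = 0"
        using cpole_list_bots[OF xs, of n] \<open>n = N + 2\<close> by (simp add: s_def)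
      then show ?thesis using \<open>snd z = 0\<close> admissible_red[OF \<open>n = N + 2\<close>] fz s
        by (simp add: add_mset_commute)
    next
      case (red' n)
      then have "fst z \<subseteq># replicate_mset n SB"
        by (metis add_mset_add_single add_right_imp_eq mset_subset_eq_add_right)
      then obtain i where "i \<le> n" "fst z = replicate_mset i SB"
        by (auto simp: subseteq_replicate_mset_iff)
      then show ?thesis
        using has_charge_small[OF cz] \<open>n = N + 1\<close> N8 by auto
    next
      case gc2
      then have eq: "s + fst z = {#SGC, SU 3, SH#}"
        by (simp add: add_mset_commute)
      then have "fst x0 \<subseteq># add_mset SGC (add_mset (SU 3) (replicate_mset 1 SH))"
        using sub[OF x0(1)] by (metis mset_subset_eq_add_left One_nat_def replicate_mset_0 replicate_mset_Suc subset_mset.order_trans)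
      then obtain i j l where X: "i \<le> 1" "j \<le> 1" "l \<le> 1"
        "fst x0 = replicate_mset l SGC + replicate_mset j (SU 3) + replicate_mset i SH"
        by (rule subseteq_add_add_replicateE)
      then have ijl: "i = 0 \<or> i = 1" "j = 0 \<or> j = 1" "l = 0 \<or> l = 1" by auto
      \<comment> \<open>Unit part \<open>1\<close> requires both \<open>SGC\<close> and
        \<open>SU 3\<close>; with at most one \<open>SH\<close> the coefficient of \<open>N\<close>
        is then \<open>2\<close> or \<open>1\<close>, not a multiple of \<open>9\<close>.\<close>
      have "total_1 (fst x0) = 1" "9 dvd total_N (fst x0)"
        using has_charge_split[of N 0 1 "fst x0"] cpole_charge[OF x0(2)] N8 X(4) ijl by auto
      then show ?thesis using X(4) ijl by auto
    qed (use mem in \<open>auto split: if_splits\<close>)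
  qed
  then show "sum_list xs + z + ({#SH#}, 0) \<in> cpole"
    using ch by (intro cpoleI) (auto simp: s_def sum_list_prod)
qed

text \<open>A member is evaluated against generic tests only. Its charge and, over the generic
  sector, its resource are read off from this single point; the lemmas with the same suffix below
  serve the same purpose.\<close>

lemma mem_sem_H00_D:
  assumes "h \<in> sem (H00 N)"
  shows "(add_mset (SU 2) (replicate_mset (N + 2) SB) + fst h, snd h) \<in> cpole"
proof -
  have "sum_list (replicate (N + 2) ({#SB#}, 0)) + ({#SU 2#}, 0) + h \<in> cpole"
    using assms[unfolded mem_sem_H00] unit_cpole tester_bottoms[of 2]
    by (metis (no_types, lifting) exponents_def insertI1 UnI1 length_replicate set_replicate_conv_if
        singletonD subsetI empty_iff)
  then show ?thesis
    unfolding sum_list_unit by (simp add: plus_prod_def)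
qed

lemma sem_H00_charge:
  assumes "h \<in> sem (H00 N)" shows "has_charge N (- int N) (fst h)"
proof -
  have "has_charge N 1 (fst h + add_mset (SU 2) (replicate_mset (N + 2) SB))"
    using cpole_charge[OF mem_sem_H00_D[OF assms]] by (simp only: fst_conv add.commute)
  from has_charge_cancel[OF this has_charge_total] show ?thesis by simp
qed

lemma sem_H00_zero:
  assumes "h \<in> sem (H00 N)" "fst h = {#SH#}" shows "snd h = 0"
proof -
  have "\<exists>n. n = N + 2" by simp
  then obtain n where n: "n = N + 2" ..
  have "(add_mset SH (add_mset (SU 2) (replicate_mset n SB)), snd h) \<in> cpole"
    using mem_sem_H00_D[OF assms(1)] assms(2) n by (simp add: add_mset_commute)
  then show ?thesis
    using cpole_admissible[of "(_, snd h)"] n by (fastforce simp: admissible_def)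
qed

section \<open>The formula \<open>C00\<close> and its premise\<close>

definition C_tests :: "point set" where
  "C_tests = sem (tensor_power (H00 N) 2 \<multimap> tensor_power \<bottom> 3)"

lemma mem_C_tests:
  "y \<in> C_tests \<longleftrightarrow> (\<forall>hs z. length hs = 2 \<and> set hs \<subseteq> sem (H00 N) \<and> z \<in> bottoms 3 \<longrightarrow>
     sum_list hs + z + y \<in> cpole)"
proof -
  have "C_tests = orth (sum_list (replicate 2 (sem (H00 N))) + bottoms 3)"
    by (simp add: C_tests_def orth_sem_bots) (simp add: sem_tensor_power orth_closure_add)
  then show ?thesis by (simp only: orth_replicate_add)
qed

text \<open>In \<open>gc2\<close> each of the two members of \<open>H00\<close> must be one
  \<open>SH\<close>, and the rest is \<open>SU 3\<close>. In \<open>gc1\<close> a member of charge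
  \<open>-N\<close> would have to be formed from \<open>SC\<close> and \<open>SU 3\<close>, which is
  impossible because \<open>SC\<close> has charge \<open>-2N\<close>.\<close>

lemma SGC_mem: "({#SGC#}, 0) \<in> C_tests"
  unfolding mem_C_tests
proof (intro allI impI, elim conjE)
  fix hs z assume len: "length hs = 2" and hs: "set hs \<subseteq> sem (H00 N)" and z: "z \<in> bottoms 3"
  define s where "s = sum_list (map fst hs)"
  have sub: "fst x \<subseteq># s" if "x \<in> set hs" for x
    using that sum_list_member_subset[of "fst x" "map fst hs"] by (simp add: s_def)
  have hch: "has_charge N (-1 * int N + 0) (fst h)" if "h \<in> set hs" for h
    using sem_H00_charge[of h] hs that by auto
  obtain h0 where h0: "h0 \<in> set hs"
    using len by (metis hd_in_set list.size(3) zero_neq_numeral)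
  have "has_charge N (int (length (map fst hs)) * (- int N)) s"
    unfolding s_def using hch by (intro has_charge_sum_list) auto
  then have "has_charge N (2 * (- int N) + (1 - int 3) + (2 * int N + 3)) (s + fst z + {#SGC#})"
    using len has_charge_total[of N "{#SGC#}"] bottoms_charge[OF z]
    by (intro has_charge_add) auto
  then have ch: "has_charge N 1 (add_mset SGC (s + fst z))" by simp
  have "admissible (add_mset SGC (s + fst z)) (sum_list (map snd hs) + snd z)"
    if "exceptional N (add_mset SGC (s + fst z))"
  proof -
    have mem: "SGC \<in># add_mset SGC (s + fst z)" by simp
    from that show ?thesis
    proof cases
      case gc2
      then have eq: "s + fst z = add_mset (SU 3) (replicate_mset 2 SH)"
        by (simp add: add_mset_commute numeral_2_eq_2)
      have h: "fst h = {#SH#}" if "h \<in> set hs" for h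
      proof -
        have "fst h \<subseteq># add_mset (SU 3) (replicate_mset 2 SH)"
          using sub[OF that] eq by (metis mset_subset_eq_add_left subset_mset.order_trans)
        then obtain i j where ij: "i \<le> 2" "j \<le> 1" "fst h = replicate_mset j (SU 3) + replicate_mset i SH"
          by (rule subseteq_add_replicateE)
        then have j: "j = 0 \<or> j = 1" by auto
        have *: "total_1 (fst h) = 0" "9 dvd total_N (fst h) - (-1)"
          using has_charge_split[OF hch[OF that]] ij(3) j N8 by auto
        then have "j = 0" using ij(3) by simp
        then have "9 dvd 1 - int i" using * ij(3) by simp
        then have "i = 1" using ij(1) by presburger
        then show ?thesis using ij(3) \<open>j = 0\<close> by simp
      qed
      then have "s = replicate_mset 2 SH"
        unfolding s_def using sum_list_eq_replicate_mset[of "map fst hs" SH] len by auto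
      then have "fst z = {#SU 3#}" using eq by (simp add: numeral_2_eq_2)
      then have "snd z = 0" using bottoms_zero[OF z] N8 by simp
      moreover have "sum_list (map snd hs) = 0"
      proof (rule sum_list_map_eq_zero)
        fix x assume "x \<in> set hs"
        then show "snd x = 0" using h[of x] hs sem_H00_zero[of x] by auto
      qed
      ultimately show ?thesis using gc2 admissible_gc2 by simp
    next
      case gc1
      then have eq: "s + fst z = add_mset (SU 3) (replicate_mset 1 SC)"
        by (simp add: add_mset_commute)
      then have "fst h0 \<subseteq># add_mset (SU 3) (replicate_mset 1 SC)"
        using sub[OF h0] by (metis mset_subset_eq_add_left subset_mset.order_trans)
      then obtain i j where ij: "i \<le> 1" "j \<le> 1" "fst h0 = replicate_mset j (SU 3) + replicate_mset i SC"
        by (rule subseteq_add_replicateE)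
      then have c: "i = 0 \<or> i = 1" "j = 0 \<or> j = 1" by auto
      have "total_1 (fst h0) = 0" "9 dvd total_N (fst h0) - (-1)"
        using has_charge_split[OF hch[OF h0]] ij(3) c N8 by auto
      then show ?thesis using ij(3) c by auto
    qed (use mem in \<open>auto split: if_splits\<close>)
  qed
  then show "sum_list hs + z + ({#SGC#}, 0) \<in> cpole"
    using ch by (intro cpoleI) (auto simp: s_def sum_list_prod)
qed

lemma C_tests_D:
  assumes "y \<in> C_tests"
  shows "({#SH, SH, SU 3#} + fst y, snd y) \<in> cpole"
proof -
  have "set [({#SH#}, 0), ({#SH#}, 0)] \<subseteq> sem (H00 N)" using SH_mem by simp
  then have "sum_list [({#SH#}, 0), ({#SH#}, 0)] + ({#SU 3#}, 0) + y \<in> cpole"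
    using assms tester_bottoms[of 3] unfolding mem_C_tests
    by (metis (no_types, lifting) exponents_def insertI1 insertI2 UnI1 One_nat_def Suc_1 length_Cons list.size(3))
  then show ?thesis by (simp add: plus_prod_def add_mset_commute)
qed

lemma mem_sem_C00:
  "c \<in> sem (C00 N) \<longleftrightarrow> (\<forall>y\<in>C_tests. \<forall>z\<in>bottoms 3. y + z + c \<in> cpole)"
  by (simp add: C00_def orth_sem_bots orth_add_mem flip: C_tests_def del: sem.simps(9))
     (simp add: C_tests_def orth_sem_bots orth_add_mem)

lemma C_tests_charge: "y \<in> C_tests \<Longrightarrow> has_charge N (2 * int N + 3) (fst y)"
proof -
  assume "y \<in> C_tests"
  then have "has_charge N 1 (fst y + {#SH, SH, SU 3#})"
    using cpole_charge[OF C_tests_D] by (simp add: add.commute)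
  from has_charge_cancel[OF this has_charge_total] show ?thesis by (simp add: add.commute)
qed

lemma C_tests_zero:
  assumes "y \<in> C_tests" "fst y = {#SGC#}" shows "snd y = 0"
  using cpole_admissible[OF C_tests_D[OF assms(1)]] assms(2)
  by (simp add: admissible_def add_mset_commute)

text \<open>\<open>SC\<close> also occurs in \<open>goal\<close> and \<open>h1\<close>, but no part
  of these has the charge \<open>-2\<close> of \<open>z\<close>. Only \<open>gc1\<close> remains,
  split into \<open>SGC\<close> for \<open>y\<close> and \<open>SU 3\<close> for
  \<open>z\<close>.\<close>

lemma SC_mem: "({#SC#}, 0) \<in> sem (C00 N)"
  unfolding mem_sem_C00
proof (intro ballI)
  fix y z assume y: "y \<in> C_tests" and z: "z \<in> bottoms 3"
  have cz: "has_charge N (0 * int N + -2) (fst z)" using bottoms_charge[OF z] by simp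
  have "has_charge N ((2 * int N + 3) + (1 - int 3) + (-2 * int N)) (fst y + fst z + {#SC#})"
    using has_charge_total[of N "{#SC#}"] bottoms_charge[OF z] C_tests_charge[OF y]
    by (intro has_charge_add) auto
  then have ch: "has_charge N 1 (add_mset SC (fst y + fst z))" by simp
  have "admissible (add_mset SC (fst y + fst z)) (snd y + snd z)"
    if "exceptional N (add_mset SC (fst y + fst z))"
  proof -
    have mem: "SC \<in># add_mset SC (fst y + fst z)" by simp
    have sub: "fst z \<subseteq># add_mset SC (fst y + fst z)"
      by (metis add.commute add_mset_add_single mset_subset_eq_add_left union_assoc)
    from that show ?thesis
    proof cases
      case (goal t)
      obtain i j where ij: "i \<le> 6" "j \<le> 1" "fst z = replicate_mset j (SE t) + replicate_mset i SC"
        using sub[unfolded goal] by (rule subseteq_add_replicateE)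
      then have "j = 0 \<or> j = 1" by auto
      then show ?thesis
        using has_charge_split(1)[OF cz] ij(3) N8 by auto
    next
      case gc1
      then have eq: "fst y + fst z = {#SGC, SU 3#}"
        by (simp add: add_mset_commute)
      then have "fst z \<subseteq># add_mset SGC (replicate_mset 1 (SU 3))"
        by (metis mset_subset_eq_add_right One_nat_def replicate_mset_0 replicate_mset_Suc)
      then obtain i j where ij: "i \<le> 1" "j \<le> 1" "fst z = replicate_mset j SGC + replicate_mset i (SU 3)"
        by (rule subseteq_add_replicateE)
      then have "i = 0 \<or> i = 1" "j = 0 \<or> j = 1" by auto
      then have "j = 0" "i = 1"
        using has_charge_split(1)[OF cz] ij(3) N8 by auto
      then have fz: "fst z = {#SU 3#}" using ij(3) by simp
      then have "snd z = 0" using bottoms_zero[OF z] N8 by simp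
      moreover have "fst y = {#SGC#}" using eq fz by simp
      ultimately show ?thesis using gc1 C_tests_zero[OF y] admissible_gc1 by (simp add: add_mset_commute)
    next
      case h1
      obtain i j where ij: "i \<le> 4" "j \<le> 1" "fst z = replicate_mset j (SU N) + replicate_mset i SC"
        using sub[unfolded h1] by (rule subseteq_add_replicateE)
      then have "j = 0 \<or> j = 1" by auto
      then show ?thesis
        using has_charge_split(1)[OF cz] ij(3) N8 by auto
    qed (use mem in \<open>auto split: if_splits\<close>)
  qed
  then show "y + z + ({#SC#}, 0) \<in> cpole"
    using ch by (intro cpoleI) auto
qed

lemma mem_sem_C00_D:
  assumes "c \<in> sem (C00 N)" shows "({#SGC, SU 3#} + fst c, snd c) \<in> cpole"
proof -
  have "({#SGC#}, 0) + ({#SU 3#}, 0) + c \<in> cpole"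
    using assms[unfolded mem_sem_C00] SGC_mem tester_bottoms[of 3, unfolded exponents_def] by blast
  then show ?thesis by (simp add: plus_prod_def add_mset_commute)
qed

lemma sem_C00_charge:
  assumes "c \<in> sem (C00 N)" shows "has_charge N (-2 * int N) (fst c)"
proof -
  have "has_charge N 1 (fst c + {#SGC, SU 3#})"
    using cpole_charge[OF mem_sem_C00_D[OF assms]] by (simp add: add.commute)
  from has_charge_cancel[OF this has_charge_total] show ?thesis by simp
qed

lemma sem_C00_zero:
  assumes "c \<in> sem (C00 N)" "fst c = {#SC#}" shows "snd c = 0"
  using cpole_admissible[OF mem_sem_C00_D[OF assms(1)]] assms(2)
  by (simp add: admissible_def add_mset_commute)

section \<open>The formula \<open>H1\<close>\<close>

lemma mem_sem_H1:
  "x \<in> sem (H1 N) \<longleftrightarrow> (\<forall>cs z. length cs = 4 \<and> set cs \<subseteq> sem (C00 N) \<and> z \<in> bottoms N \<longrightarrow>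
     sum_list cs + z + x \<in> cpole)"
proof -
  have "sem (H1 N) = orth (sum_list (replicate 4 (sem (C00 N))) + bottoms N)"
    by (simp add: H1_def orth_sem_bots) (simp add: sem_tensor_power orth_closure_add)
  then show ?thesis by (simp only: orth_replicate_add)
qed

lemma sem_C00_list_charge:
  assumes "set cs \<subseteq> sem (C00 N)"
  shows "has_charge N (int (length cs) * (-2 * int N)) (sum_list (map fst cs))"
  using has_charge_sum_list[of "map fst cs" N "-2 * int N"] assms sem_C00_charge by fastforce

lemma sem_C00_list:
  assumes "set cs \<subseteq> sem (C00 N)" "length cs \<ge> 4" "exceptional N s" "sum_list (map fst cs) \<subseteq># s"
  shows "sum_list (map fst cs) = replicate_mset (length cs) SC" "sum_list (map snd cs) = 0"
    and "(\<exists>t. s = add_mset (SE t) (replicate_mset 6 SC)) \<or> s = add_mset (SU N) (replicate_mset 4 SC)"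
proof -
  have ch: "has_charge N (-2 * int N) c" if "c \<in> set (map fst cs)" for c
    using that assms(1) sem_C00_charge by fastforce
  note * = exceptional_C_list[OF assms(3,4) ch _ N8]
  show "(\<exists>t. s = add_mset (SE t) (replicate_mset 6 SC)) \<or> s = add_mset (SU N) (replicate_mset 4 SC)"
    using *(2) assms(2) by simp
  have c: "\<forall>c\<in>set (map fst cs). c = {#SC#}"
    using *(1) assms(2) by simp
  have "sum_list (map fst cs) = replicate_mset (length (map fst cs)) SC"
    by (rule sum_list_eq_replicate_mset) (use c in blast)
  then show "sum_list (map fst cs) = replicate_mset (length cs) SC"
    by simp
  show "sum_list (map snd cs) = 0"
  proof (rule sum_list_map_eq_zero)
    fix x assume "x \<in> set cs"
    then show "snd x = 0" using c assms(1) sem_C00_zero[of x] by auto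
  qed
qed

lemma wild_mem: "({#}, wild) \<in> sem (H1 N)"
  unfolding mem_sem_H1
proof (intro allI impI, elim conjE)
  fix cs z assume len: "length cs = 4" and cs: "set cs \<subseteq> sem (C00 N)" and z: "z \<in> bottoms N"
  define s where "s = sum_list (map fst cs)"
  have "has_charge N (int 4 * (-2 * int N) + (1 - int N)) (s + fst z)"
    using sem_C00_list_charge[OF cs] len bottoms_charge[OF z] by (intro has_charge_add) (auto simp: s_def)
  \<comment> \<open>The charge is \<open>1 - 9N\<close>: the modulus makes it
    \<open>1\<close>.\<close>
  then have ch: "has_charge N 1 (s + fst z)"
    by (rule has_charge_cong[of _ _ _ _ 1]) simp
  have "admissible (s + fst z) (sum_list (map snd cs) + snd z + wild)"
    if exc: "exceptional N (s + fst z)"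
  proof -
    note cs' = sem_C00_list[OF cs _ exc, folded s_def]
    have s: "s = replicate_mset 4 SC" and q: "sum_list (map snd cs) = 0"
      using cs' len by simp_all
    consider t where "s + fst z = add_mset (SE t) (replicate_mset 6 SC)"
      | "s + fst z = add_mset (SU N) (replicate_mset 4 SC)"
      using cs' len by auto
    then show ?thesis
    proof cases
      case 1
      \<comment> \<open>The goal sector restricts only resources with first component
        \<open>0\<close>, and \<open>wild\<close> contributes \<open>1\<close> to it.\<close>
      show ?thesis
        unfolding 1 by (rule admissible_goal) (auto simp: wild_def plus_prod_def)
    next
      case 2
      then have "fst z = {#SU N#}" using s by simp
      then have "snd z = 0" using bottoms_zero[OF z] N8 by simp
      then show ?thesis using 2 q admissible_h1 by simp
    qed
  qed
  then show "sum_list cs + z + ({#}, wild) \<in> cpole"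
    using ch by (intro cpoleI) (auto simp: s_def sum_list_prod)
qed

lemma mem_sem_H1_D:
  assumes "x \<in> sem (H1 N)" shows "(add_mset (SU N) (replicate_mset 4 SC) + fst x, snd x) \<in> cpole"
proof -
  have 1: "set (replicate 4 ({#SC#}, 0)) \<subseteq> sem (C00 N)" using SC_mem by auto
  have 2: "({#SU N#}, 0) \<in> bottoms N" by (rule tester_bottoms) (simp add: exponents_def)
  have 3: "sum_list (replicate n ({#SC#}, 0::resource)) = (replicate_mset n SC, 0)" for n
    by (induction n) (auto simp: zero_prod_def)
  have "sum_list (replicate 4 ({#SC#}, 0)) + ({#SU N#}, 0) + x \<in> cpole"
    using assms 1 2 unfolding mem_sem_H1 by (metis length_replicate)
  then show ?thesis unfolding 3 by (simp add: plus_prod_def)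
qed

lemma sem_H1_charge:
  assumes "x \<in> sem (H1 N)" shows "has_charge N 0 (fst x)"
proof -
  have "has_charge N 1 (fst x + add_mset (SU N) (replicate_mset 4 SC))"
    using cpole_charge[OF mem_sem_H1_D[OF assms]] by (simp add: add.commute)
  from has_charge_cancel[OF this has_charge_total]
  show ?thesis by (rule has_charge_cong[of _ _ _ _ "-1"]) simp
qed

lemma sem_H1_wild:
  assumes "x \<in> sem (H1 N)" "fst x = {#}" shows "snd x = wild"
  using cpole_admissible[OF mem_sem_H1_D[OF assms(1)]] assms(2) by (simp add: admissible_def)

section \<open>Encoded literals and their tests\<close>

definition D_tests :: "nat \<Rightarrow> point set" where
  "D_tests k = sem (H1 N \<multimap> tensor_power \<bottom> k)"

lemma mem_D_tests: "y \<in> D_tests k \<longleftrightarrow> (\<forall>h\<in>sem (H1 N). \<forall>z\<in>bottoms k. h + z + y \<in> cpole)"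
  by (simp add: D_tests_def orth_sem_bots orth_add_mem)

lemma mem_sem_D_lit:
  "x \<in> sem (D_lit N m) \<longleftrightarrow> (\<forall>y\<in>D_tests (m + 4). \<forall>z\<in>bottoms (m + 4). y + z + x \<in> cpole)"
  by (simp add: D_lit_def D_tests_def orth_sem_bots orth_add_mem)

lemma SG_mem:
  assumes k: "5 \<le> k" "k \<le> N - 3" shows "({#SG k#}, 0) \<in> D_tests k"
  unfolding mem_D_tests
proof (intro ballI)
  fix h z assume h: "h \<in> sem (H1 N)" and z: "z \<in> bottoms k"
  have k': "5 \<le> int k" "int k \<le> int N - 3" using k N8 by auto
  have "has_charge N (0 + (1 - int k) + int k) (fst h + fst z + {#SG k#})"
    using sem_H1_charge[OF h] bottoms_charge[OF z] has_charge_total[of N "{#SG k#}"]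
    by (intro has_charge_add) auto
  then have ch: "has_charge N 1 (add_mset (SG k) (fst h + fst z))" by simp
  have "admissible (add_mset (SG k) (fst h + fst z)) (snd h + snd z)"
    if "exceptional N (add_mset (SG k) (fst h + fst z))"
  proof -
    have mem: "SG k \<in># add_mset (SG k) (fst h + fst z)" by simp
    from that show ?thesis
    proof cases
      case (lit j)
      then have "j = k" using mem by auto
      then have eq: "fst h + fst z = {#SU k#}" using lit by simp
      then have "fst z \<subseteq># {#SU k#}" by (metis mset_subset_eq_add_right)
      then have "fst z = {#} \<or> fst z = {#SU k#}" by (auto simp: subseteq_add_mset_iff)
      then have fz: "fst z = {#SU k#}"
        using has_charge_small[OF bottoms_charge[OF z]] k k' by (elim disjE) auto
      then have "snd z = 0" using bottoms_zero[OF z fz] k by simp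
      moreover have "fst h = {#}" using eq fz by simp
      ultimately show ?thesis
        using fz sem_H1_wild[OF h] admissible_lit[of wild k] by simp
    qed (use mem in \<open>auto split: if_splits\<close>)
  qed
  then show "h + z + ({#SG k#}, 0) \<in> cpole"
    using ch by (intro cpoleI) auto
qed

lemma D_tests_D:
  assumes "y \<in> D_tests k" "k \<in> exponents" shows "(add_mset (SU k) (fst y), wild + snd y) \<in> cpole"
proof -
  have "({#}, wild) + ({#SU k#}, 0) + y \<in> cpole"
    using assms(1)[unfolded mem_D_tests] wild_mem tester_bottoms[OF assms(2)] by blast
  then show ?thesis by (simp add: plus_prod_def)
qed

lemma D_tests_charge:
  assumes "y \<in> D_tests k" "k \<in> exponents" shows "has_charge N (int k) (fst y)"
proof -
  have "has_charge N 1 (fst y + {#SU k#})"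
    using cpole_charge[OF D_tests_D[OF assms]] by simp
  from has_charge_cancel[OF this has_charge_total] show ?thesis by simp
qed

lemma wild_add_ne: "wild + q \<noteq> 0" "wild + q \<noteq> lits W" "wild + q = wild \<longleftrightarrow> q = 0"
  by (cases q; simp add: wild_def lits_def zero_prod_def)+

text \<open>The sector is shared by \<open>y\<close> of charge \<open>k\<close> and \<open>z\<close>
  of charge \<open>1 - k\<close>. The bounds \<open>5 \<le> k \<le> N - 3\<close> rule out these
  charges in most exceptional sectors. Besides \<open>lit\<close> there remain those where copies of
  \<open>SB\<close> can supply the charge; they are refuted by testing \<open>y\<close> against
  \<open>wild\<close> and \<open>SU k\<close>, or \<open>z\<close> against \<open>k\<close> copies
  of \<open>SB\<close>.\<close>

lemma lits_mem:
  assumes m: "m \<in> {1..N - 7}" shows "({#}, lits {#m#}) \<in> sem (D_lit N m)"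
  unfolding mem_sem_D_lit
proof (intro ballI)
  fix y z
  define k where "k = m + 4"
  assume "y \<in> D_tests (m + 4)" "z \<in> bottoms (m + 4)"
  then have y: "y \<in> D_tests k" and z: "z \<in> bottoms k" by (simp_all add: k_def)
  have k: "5 \<le> k" "k \<le> N - 3" and k': "5 \<le> int k" "int k \<le> int N - 3" and kN: "2 \<le> k" "k \<le> N"
    using m N8 by (auto simp: k_def)
  then have ke: "k \<in> exponents" by (simp add: exponents_def)
  note cy = D_tests_charge[OF y ke] and cz = bottoms_charge[OF z]
  have cy': "has_charge N (0 * int N + int k) (fst y)"
    and cz': "has_charge N (0 * int N + (1 - int k)) (fst z)"
    using cy cz by simp_all
  note y' = cpole_admissible[OF D_tests_D[OF y ke], simplified]
  \<comment> \<open>Together with \<open>SU k\<close> such a \<open>y\<close> would lie in the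
    sector \<open>bots\<close>, where the resource must be \<open>0\<close>, whereas
    \<open>y\<close> is tested with \<open>wild\<close> added.\<close>
  have bots_False: False if "fst y = replicate_mset k SB"
    using y' that kN wild_add_ne(1) unfolding admissible_def by metis
  define s where "s = fst y + fst z"
  have suby: "fst y \<subseteq># s" and subz: "fst z \<subseteq># s" by (simp_all add: s_def)
  have "has_charge N (int k + (1 - int k)) s"
    unfolding s_def by (intro has_charge_add cy cz)
  then have ch: "has_charge N 1 s" by simp
  have "admissible s (snd y + snd z + lits {#m#})" if "exceptional N s"
    using that
  proof cases
    case (goal t)
    from subz[unfolded goal] obtain i j
      where ij: "i \<le> 6" "j \<le> 1" "fst z = replicate_mset j (SE t) + replicate_mset i SC"
      by (rule subseteq_add_replicateE)
    then have "j = 0 \<or> j = 1" by auto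
    then show ?thesis
      using has_charge_split(1)[OF cz'] ij(3) k' by (elim disjE) auto
  next
    case unit
    then have "fst z = {#} \<or> fst z = {#SB#}" using subz by (auto simp: subseteq_add_mset_iff)
    then show ?thesis
      using has_charge_small[OF cz] k' by (elim disjE) auto
  next
    case (bots j)
    from suby[unfolded bots(1)] obtain i l
      where il: "i \<le> j" "l \<le> 1" "fst y = replicate_mset l (SU j) + replicate_mset i SB"
      by (rule subseteq_add_replicateE)
    then have l: "l = 0 \<or> l = 1" by auto
    have "l = 0" "i = k"
      using l has_charge_small[OF cy] il(1,3) k' bots(2,3) by (elim disjE; simp)+
    then show ?thesis using bots_False il by simp
  next
    case (red n)
    from suby[unfolded red(1)] obtain i j l
      where ijl: "i \<le> n" "j \<le> 1" "l \<le> 1"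
        "fst y = replicate_mset l SH + replicate_mset j (SU 2) + replicate_mset i SB"
      by (rule subseteq_add_add_replicateE)
    then have jl: "j = 0 \<or> j = 1" "l = 0 \<or> l = 1" by auto
    have tot: "total_N (fst y) * int N + total_1 (fst y) = int i - int j - int l * int N"
      using ijl(4) by simp
    have iN: "int i \<le> int N + 2" using ijl(1) \<open>n = N + 2\<close> by simp
    have "int i - int j - int l * int N = int k"
      using has_charge_small[OF cy] jl iN k' N8 unfolding tot by (elim disjE) simp_all
    then have "l = 0" "int i = int k + int j"
      using jl iN k' by (elim disjE; simp)+
    then have "i = k + j" by simp
    show ?thesis
    proof (cases "j = 0")
      case True
      then show ?thesis using bots_False ijl(4) \<open>l = 0\<close> \<open>i = k + j\<close> by simp
    next
      case False
      then have "j = 1" using jl by simp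
      then have fy: "fst y = add_mset (SU 2) (replicate_mset (k + 1) SB)"
        using ijl(4) \<open>l = 0\<close> \<open>i = k + j\<close> by simp
      \<comment> \<open>\<open>z\<close> gets the rest of the sector, \<open>SH\<close> and
        \<open>r = N + 1 - k\<close> copies of \<open>SB\<close>. The \<open>k\<close> further
        copies used for testing it complete the sector with \<open>SH\<close> and
        \<open>N + 1\<close> copies of \<open>SB\<close>, which the pole excludes.\<close>
      define r where "r = n - (k + 1)"
      have "n = (k + 1) + r" using \<open>i = k + j\<close> \<open>j = 1\<close> ijl(1) by (simp add: r_def)
      then have "replicate_mset n SB = replicate_mset (k + 1) SB + replicate_mset r SB"
        by (metis replicate_mset_add)
      then have "fst z = add_mset SH (replicate_mset r SB)"
        using red(1) fy by (simp add: s_def add_mset_commute)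
      then have "admissible (add_mset SH (replicate_mset (k + r) SB)) (snd z)"
        using cpole_admissible[OF bottoms_bots[OF z]] by (simp add: replicate_mset_add)
      moreover have "k + r = N + 1" using \<open>n = (k + 1) + r\<close> \<open>n = N + 2\<close> by simp
      ultimately show ?thesis unfolding admissible_def by metis
    qed
  next
    case (red' n)
    from suby[unfolded red'(1)] obtain i l
      where il: "i \<le> n" "l \<le> 1" "fst y = replicate_mset l SH + replicate_mset i SB"
      by (rule subseteq_add_replicateE)
    then have l: "l = 0 \<or> l = 1" by auto
    have tot: "total_N (fst y) * int N + total_1 (fst y) = int i - int l * int N"
      using il(3) by simp
    have iN: "int i \<le> int N + 1" using il(1) \<open>n = N + 1\<close> by simp
    have "int i - int l * int N = int k"
      using has_charge_small[OF cy] l iN k' N8 unfolding tot by (elim disjE) simp_all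
    then have "l = 0" "i = k"
      using l iN k' by (elim disjE; simp)+
    then show ?thesis using bots_False il by simp
  next
    case gc2
    then have "fst y \<subseteq># add_mset SGC (add_mset (SU 3) (replicate_mset 2 SH))"
      using suby by (simp add: numeral_2_eq_2 add_mset_commute)
    then obtain i j l where ijl: "i \<le> 2" "j \<le> 1" "l \<le> 1"
      "fst y = replicate_mset l SGC + replicate_mset j (SU 3) + replicate_mset i SH"
      by (rule subseteq_add_add_replicateE)
    then have "j = 0 \<or> j = 1" "l = 0 \<or> l = 1" by auto
    then show ?thesis
      using has_charge_split(1)[OF cy'] ijl(4) k' by (elim disjE) auto
  next
    case gc1
    then have "fst y \<subseteq># add_mset SGC (add_mset (SU 3) (replicate_mset 1 SC))"
      using suby by (simp add: add_mset_commute)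
    then obtain i j l where ijl: "i \<le> 1" "j \<le> 1" "l \<le> 1"
      "fst y = replicate_mset l SGC + replicate_mset j (SU 3) + replicate_mset i SC"
      by (rule subseteq_add_add_replicateE)
    then have "j = 0 \<or> j = 1" "l = 0 \<or> l = 1" by auto
    then show ?thesis
      using has_charge_split(1)[OF cy'] ijl(4) k' by (elim disjE) auto
  next
    case h1
    from subz[unfolded h1] obtain i j
      where ij: "i \<le> 4" "j \<le> 1" "fst z = replicate_mset j (SU N) + replicate_mset i SC"
      by (rule subseteq_add_replicateE)
    then have "j = 0 \<or> j = 1" by auto
    then show ?thesis
      using has_charge_split(1)[OF cz'] ij(3) k' by (elim disjE) auto
  next
    case (lit j)
    have j': "5 \<le> int j" "int j \<le> int N - 3" using lit N8 by auto
    have "fst y \<subseteq># add_mset (SG j) (replicate_mset 1 (SU j))" using suby lit(1) by simp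
    then obtain i l where il: "i \<le> 1" "l \<le> 1" "fst y = replicate_mset l (SG j) + replicate_mset i (SU j)"
      by (rule subseteq_add_replicateE)
    then have "i = 0 \<or> i = 1" "l = 0 \<or> l = 1" by auto
    then have "l = 1" "i = 0" "j = k"
      using has_charge_small[OF cy] il(3) k' j' by (elim disjE; simp)+
    then have fy: "fst y = {#SG k#}" using il(3) by simp
    then have fz: "fst z = {#SU k#}" using lit(1) \<open>j = k\<close> by (simp add: s_def)
    have "admissible {#SG k, SU k#} (wild + snd y)"
      using y' fy by (simp add: add_mset_commute)
    then have "wild + snd y = wild \<or> wild + snd y = lits {#k - 4#}"
      using k by (auto simp: admissible_def)
    \<comment> \<open>A resource containing an element of \<open>H1\<close> is never a
      \<open>lits\<close>, so the second alternative is void and \<open>wild\<close>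
      cancels.\<close>
    then have "snd y = 0" using wild_add_ne by blast
    moreover have "snd z = 0" using bottoms_zero[OF z fz] kN by simp
    moreover have "k - 4 = m" by (simp add: k_def)
    ultimately show ?thesis
      using lit(1) \<open>j = k\<close> admissible_lit[of "lits {#m#}" k] by simp
  qed
  then show "y + z + ({#}, lits {#m#}) \<in> cpole"
    using ch by (intro cpoleI) (auto simp: s_def)
qed

lemma mem_sem_D_lit_D:
  assumes "x \<in> sem (D_lit N m)" "m \<in> {1..N - 7}"
  shows "({#SG (m + 4), SU (m + 4)#} + fst x, snd x) \<in> cpole"
proof -
  have k: "5 \<le> m + 4" "m + 4 \<le> N - 3" using assms(2) N8 by auto
  then have "m + 4 \<in> exponents" by (simp add: exponents_def)
  then have "({#SG (m + 4)#}, 0) + ({#SU (m + 4)#}, 0) + x \<in> cpole"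
    using assms(1)[unfolded mem_sem_D_lit] SG_mem[OF k] tester_bottoms by blast
  then show ?thesis by (simp add: plus_prod_def add_mset_commute)
qed

lemma sem_D_lit_charge:
  assumes "x \<in> sem (D_lit N m)" "m \<in> {1..N - 7}" shows "has_charge N 0 (fst x)"
proof -
  have "has_charge N 1 (fst x + {#SG (m + 4), SU (m + 4)#})"
    using cpole_charge[OF mem_sem_D_lit_D[OF assms]] by (simp add: add.commute)
  from has_charge_cancel[OF this has_charge_total] show ?thesis by simp
qed

lemma sem_D_lit_res:
  assumes "x \<in> sem (D_lit N m)" "m \<in> {1..N - 7}" "fst x = {#}"
  shows "snd x = wild \<or> snd x = lits {#m#}"
proof -
  have k: "5 \<le> m + 4" "m + 4 \<le> N - 3" using assms(2) N8 by auto
  have "admissible {#SG (m + 4), SU (m + 4)#} (snd x)"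
    using cpole_admissible[OF mem_sem_D_lit_D[OF assms(1,2)]] assms(3) by simp
  then show ?thesis
    using k unfolding admissible_def by (metis add_diff_cancel_right')
qed

subsection \<open>Interpretation of the encoded formulas\<close>

definition resource :: "product \<Rightarrow> product nform multiset \<Rightarrow> nat \<Rightarrow> point" where
  "resource W \<Delta> i = ({#}, 0, W, \<Delta>, i)"

text \<open>The orthogonal of \<open>E\<close> in closed form, see \<open>orth_sem_E\<close>. Six
  factors \<open>C00\<close> have charge \<open>-12N\<close>, so a test has charge
  \<open>12N + 1\<close>, congruent to \<open>3N + 1\<close>. Over sectors other than a single
  \<open>SE t\<close> the charge is the only condition.\<close>

definition E_tests :: "product \<Rightarrow> point set" where
  "E_tests X = {v. has_charge N (3 * int N + 1) (fst v) \<and>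
     (\<forall>t x \<Delta> i. v = ({#SE t#}, 0, x, \<Delta>, i) \<longrightarrow> provable t (x + X, \<Delta>, i))}"

definition E_gens :: "nat list \<Rightarrow> point set" where
  "E_gens X = sum_list (replicate 6 (sem (C00 N))) + sum_list (map (\<lambda>m. sem (D_lit N m)) X)"

lemma sem_E: "sem (E N X) = orth (orth (E_gens X))"
  by (simp add: E_def D_prod_def sem_tensor_power sem_tensor_list E_gens_def comp_def
      orth_closure_add orth_closure_add_right)

lemma E_point_gens:
  assumes "set X \<subseteq> {1..N - 7}" shows "(replicate_mset 6 SC, lits (mset X)) \<in> E_gens X"
proof -
  have 1: "sum_list (replicate n ({#SC#}, 0::resource)) = (replicate_mset n SC, 0)" for n
    by (induction n) (auto simp: zero_prod_def)
  have "(replicate_mset 6 SC, 0) \<in> sum_list (replicate 6 (sem (C00 N)))"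
    unfolding mem_sum_list_replicate
    by (rule exI[of _ "replicate 6 ({#SC#}, 0)"]) (use SC_mem in \<open>auto simp: 1\<close>)
  moreover have "({#}, lits (mset X)) \<in> sum_list (map (\<lambda>m. sem (D_lit N m)) X)"
    using assms
  proof (induction X)
    case Nil
    show ?case by (simp add: lits_def zero_prod_def)
  next
    case (Cons m X)
    then have "({#}, lits {#m#}) + ({#}, lits (mset X)) \<in> sum_list (map (\<lambda>m. sem (D_lit N m)) (m # X))"
      using lits_mem by (simp add: set_plus_intro del: add_Pair)
    then show ?case by (simp add: lits_def zero_prod_def)
  qed
  ultimately have "(replicate_mset 6 SC, 0) + ({#}, lits (mset X)) \<in> E_gens X"
    unfolding E_gens_def by (rule set_plus_intro)
  then show ?thesis by (simp add: lits_def zero_prod_def)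
qed

lemma sum_list_wild_lits:
  assumes "list_all2 (\<lambda>q m. q = wild \<or> q = lits {#m#}) qs X" "fst (sum_list qs) = 0"
  shows "sum_list qs = lits (mset X)"
  using assms
proof (induction rule: list_all2_induct)
  case Nil
  show ?case by (simp add: lits_def zero_prod_def)
next
  case (Cons q qs m X)
  then have "q = lits {#m#}" "sum_list qs = lits (mset X)" by (auto simp: wild_def)
  then show ?case by (simp add: lits_def)
qed

text \<open>One inclusion tests against the generic point of \<open>E\<close>. For the other,
  arbitrary factors of \<open>E\<close> are forced back to generic ones whenever the sum is
  exceptional.\<close>

lemma orth_sem_E:
  assumes X: "set X \<subseteq> {1..N - 7}" shows "orth (sem (E N X)) = E_tests (mset X)"
proof (intro equalityI subsetI)
  fix v assume "v \<in> orth (sem (E N X))"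
  then have v: "(replicate_mset 6 SC, lits (mset X)) + v \<in> cpole"
    using E_point_gens[OF X] by (auto simp: sem_E orth_iff)
  have "has_charge N 1 (fst v + replicate_mset 6 SC)"
    using cpole_charge[OF v] by (simp add: add.commute)
  from has_charge_cancel[OF this has_charge_total]
  have "has_charge N (3 * int N + 1) (fst v)"
    by (rule has_charge_cong[of _ _ _ _ "-1"]) simp
  moreover have "provable t (x + mset X, \<Delta>, i)" if "v = ({#SE t#}, 0, x, \<Delta>, i)" for t x \<Delta> i
  proof -
    have "admissible (add_mset (SE t) (replicate_mset 6 SC)) (0, x + mset X, \<Delta>, i)"
      using cpole_admissible[OF v] that by (simp add: lits_def zero_prod_def add.commute)
    then show ?thesis unfolding admissible_def by blast
  qed
  ultimately show "v \<in> E_tests (mset X)" by (simp add: E_tests_def)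
next
  fix v assume v: "v \<in> E_tests (mset X)"
  then have cv: "has_charge N (3 * int N + 1) (fst v)" by (simp add: E_tests_def)
  have "c + d + v \<in> cpole"
    if c: "c \<in> sum_list (replicate 6 (sem (C00 N)))" and d: "d \<in> sum_list (map (\<lambda>m. sem (D_lit N m)) X)"
    for c d
  proof -
    obtain cs where cs: "length cs = 6" "set cs \<subseteq> sem (C00 N)" "c = sum_list cs"
      using c by (auto simp: mem_sum_list_replicate)
    obtain ds where ds: "list_all2 (\<lambda>d m. d \<in> sem (D_lit N m)) ds X" "d = sum_list ds"
      using d by (auto simp: mem_sum_list_map)
    have dD: "list_all2 (\<lambda>d m. d \<in> sem (D_lit N m) \<and> m \<in> {1..N - 7}) ds X"
      using ds(1) X unfolding list_all2_conv_all_nth by (metis nth_mem subsetD)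
    then have dcharge: "has_charge N 0 (fst d)" if "d \<in> set ds" for d
      using that dD sem_D_lit_charge unfolding list_all2_conv_all_nth in_set_conv_nth by metis
    have "has_charge N (int (length (map fst ds)) * 0) (sum_list (map fst ds))"
      using dcharge by (intro has_charge_sum_list) auto
    then have "has_charge N (int 6 * (-2 * int N) + 0 + (3 * int N + 1)) (fst c + fst d + fst v)"
      using sem_C00_list_charge[OF cs(2)] cs(1) cv
      by (intro has_charge_add) (auto simp: cs(3) ds(2) sum_list_prod)
    then have ch: "has_charge N 1 (fst c + fst d + fst v)"
      by (rule has_charge_cong[of _ _ _ _ 1]) simp
    have "admissible (fst c + fst d + fst v) (snd c + snd d + snd v)"
      if exc: "exceptional N (fst c + fst d + fst v)"
    proof -
      have sub: "sum_list (map fst cs) \<subseteq># fst c + fst d + fst v"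
        by (simp add: cs(3) sum_list_prod)
      note c' = sem_C00_list[OF cs(2) _ exc sub]
      have c6: "fst c = replicate_mset 6 SC" and c0: "snd c = 0"
        using c' cs by (simp_all add: sum_list_prod)
      \<comment> \<open>\<open>h1\<close> has four copies of \<open>SC\<close>; the exponent
        \<open>6\<close> in \<open>E\<close> therefore singles out the goal sector.\<close>
      have six: "count (fst c + fst d + fst v) SC \<ge> 6" by (simp add: c6)
      have "fst c + fst d + fst v \<noteq> add_mset (SU N) (replicate_mset 4 SC)"
      proof
        assume eq: "fst c + fst d + fst v = add_mset (SU N) (replicate_mset 4 SC)"
        from six[unfolded eq] show False by simp
      qed
      then obtain t where t: "fst c + fst d + fst v = add_mset (SE t) (replicate_mset 6 SC)"
        using c' cs(1) by auto
      then have dv: "fst d + fst v = {#SE t#}" by (simp add: c6)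
      \<comment> \<open>Literal factors have charge \<open>0\<close>, while \<open>SE t\<close> has
        not, so \<open>SE t\<close> must come from \<open>v\<close>.\<close>
      have dfst: "fst d' = {#}" if "d' \<in> set ds" for d'
      proof -
        have "fst d' \<subseteq># fst d"
          using that sum_list_member_subset[of "fst d'" "map fst ds"] by (simp add: ds(2) sum_list_prod)
        then have "fst d' \<subseteq># {#SE t#}" using dv
          by (metis mset_subset_eq_add_left subset_mset.order_trans)
        then have "fst d' = {#} \<or> fst d' = {#SE t#}" by (auto simp: subseteq_add_mset_iff)
        then show ?thesis
          using has_charge_small[OF dcharge[OF that]] N8 by (elim disjE) auto
      qed
      then have "fst d = {#}"
        unfolding ds(2) sum_list_prod by (intro sum_list_eq_zero) auto
      then have fv: "fst v = {#SE t#}" using dv by simp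
      have dsnd: "list_all2 (\<lambda>q m. q = wild \<or> q = lits {#m#}) (map snd ds) X"
        using dD dfst sem_D_lit_res by (auto simp: list_all2_conv_all_nth)
      have "provable t r" if r: "snd c + snd d + snd v = (0, r)" for r
      proof -
        \<comment> \<open>No element of \<open>H1\<close> is present, so none of the literals was
          replaced by \<open>wild\<close>.\<close>
        have "fst (snd d) = 0" "fst (snd v) = 0"
          using arg_cong[OF r, of fst] by (simp_all add: c0)
        then have d: "snd d = lits (mset X)"
          using sum_list_wild_lits[OF dsnd] by (simp add: ds(2) snd_sum_list)
        obtain x \<Delta> i where v': "snd v = (0, x, \<Delta>, i)"
          using \<open>fst (snd v) = 0\<close> by (cases "snd v") auto
        then have "r = (x + mset X, \<Delta>, i)"
          using r d by (simp add: c0 lits_def zero_prod_def add.commute)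
        moreover have "v = ({#SE t#}, 0, x, \<Delta>, i)" using v' fv by (simp add: prod_eq_iff)
        ultimately show ?thesis using v by (simp add: E_tests_def)
      qed
      then show ?thesis unfolding t by (rule admissible_goal)
    qed
    then show "c + d + v \<in> cpole" using ch by (intro cpoleI) auto
  qed
  then show "v \<in> orth (sem (E N X))"
    by (simp add: sem_E E_gens_def orth_add_mem)
qed

lemma E_tests_charge: "w \<in> E_tests X \<Longrightarrow> has_charge N (3 * int N + 1) (fst w)"
  by (simp add: E_tests_def)

text \<open>Two hypotheses on the same test are allowed for the sake of \<open>\<oplus>\<close>,
  whose tests are tests of both disjuncts; elsewhere the two coincide.\<close>

lemma E_tests_step:
  assumes "w \<in> E_tests X1" "w \<in> E_tests X1'"
    and "\<And>t x \<Delta> j. provable t (x + X1, \<Delta>, j) \<Longrightarrow> provable t (x + X1', \<Delta>, j) \<Longrightarrow>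
      provable t (x + W + X2, D + \<Delta>, i + j)"
  shows "w + resource W D i \<in> E_tests X2"
proof -
  have "provable t (x + X2, \<Delta>, k)" if eq: "w + resource W D i = ({#SE t#}, 0, x, \<Delta>, k)" for t x \<Delta> k
  proof -
    obtain s n y \<Delta>' j where w: "w = (s, n, y, \<Delta>', j)" by (cases w)
    have "w = ({#SE t#}, 0, y, \<Delta>', j)" "x = y + W" "\<Delta> = D + \<Delta>'" "k = i + j"
      using eq by (simp_all add: w resource_def ac_simps)
    then show ?thesis
      using assms(1,2) assms(3)[of t y \<Delta>' j] by (simp add: E_tests_def)
  qed
  then show ?thesis
    using E_tests_charge[OF assms(1)] by (simp add: E_tests_def resource_def)
qed

text \<open>A nonempty \<open>Y\<close> besides \<open>p\<close> contradicts the branch of the empty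
  goal. This is why using a formula is incompatible with the conclusion of part (b).\<close>

lemma provable_nonempty:
  assumes "provable t (x + add_mset p Y, \<Delta>, i)" "Y \<noteq> {#}"
  shows "t \<noteq> {#}" "set_mset x \<subseteq> {1..N - 7}" "p \<notin># x" "solvable N \<Gamma> (x + Y) \<Delta> t" "p \<notin># Y"
  using assms by (auto simp: provable_def not_in_iff split: if_splits)

lemma provableI:
  assumes "t \<noteq> {#}" "set_mset x \<subseteq> {1..N - 7}" "p \<notin># x" "set_mset X \<subseteq> {1..N - 7}" "p \<notin># X"
    "p \<in> {1..N - 7}" "solvable N \<Gamma> (x + X) \<Delta> t"
  shows "provable t (x + add_mset p X, \<Delta>, i)"
  using assms by (auto simp: provable_def not_in_iff)

end

locale literal_encoding = encoding +
  assumes p: "p \<in> {1..N - 7}"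
begin

section \<open>Encoded formulas act as steps of programs\<close>

lemma provable_refl:
  "set_mset V \<subseteq> {1..N - 7} \<Longrightarrow> p \<notin># V \<Longrightarrow> provable V (add_mset p V, {#}, 0)"
  using provableI[of V "{#}" V "{#}" 0] p solvable_refl[of N \<Gamma> V] by (cases "V = {#}") (auto simp: provable_def)

definition plain :: "product \<Rightarrow> bool" where
  "plain X \<longleftrightarrow> simple_product N X \<and> p \<notin># X"

lemma plainD: "plain X \<Longrightarrow> X \<noteq> {#}" "plain X \<Longrightarrow> set_mset X \<subseteq> {1..N - 7}" "plain X \<Longrightarrow> p \<notin># X"
    "plain X \<Longrightarrow> simple_product N X"
  by (auto simp: plain_def simple_product_def)

lemma provable_horn:
  assumes "provable t (x + add_mset p Y, \<Delta>, i)" "A \<in> uses (HORN X Y) Output" "consumes \<Gamma> \<Delta>' A \<Delta>"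
    and "plain X" "plain Y"
  shows "provable t (x + add_mset p X, \<Delta>', i')"
  using provable_nonempty[OF assms(1) plainD(1)[OF assms(5)]] p plainD[OF assms(4)]
    solvable_horn[OF _ assms(2,3) plainD(4)[OF assms(4)] plainD(4)[OF assms(5)]]
  by (intro provableI) auto

lemma provable_plus:
  assumes "provable t (x + add_mset p Y1, \<Delta>, i)" "provable t (x + add_mset p Y2, \<Delta>, i)"
    and "consumes \<Gamma> \<Delta>' (PlusHorn X Y1 Y2) \<Delta>" "plain X" "plain Y1" "plain Y2"
  shows "provable t (x + add_mset p X, \<Delta>', i')"
  using provable_nonempty[OF assms(1) plainD(1)[OF assms(5)]] provable_nonempty[OF assms(2) plainD(1)[OF assms(6)]]
    p plainD[OF assms(4)]
    solvable_plus[OF _ _ assms(3) plainD(4)[OF assms(4)] plainD(4)[OF assms(5)] plainD(4)[OF assms(6)]]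
  by (intro provableI) auto

lemma provable_embedded:
  assumes "provable V (s + add_mset p U, \<Delta>1, i1)" "provable t (x + add_mset p Y, \<Delta>2, i2)"
    and "consumes \<Gamma> \<Delta>' (Embedded U V Y) (\<Delta>1 + \<Delta>2)" "plain U" "plain V" "plain Y"
  shows "provable t (s + x + {#p#}, \<Delta>', i')"
proof -
  note 1 = provable_nonempty[OF assms(1) plainD(1)[OF assms(4)]]
  note 2 = provable_nonempty[OF assms(2) plainD(1)[OF assms(6)]]
  have "solvable N \<Gamma> (s + x) \<Delta>' t"
    by (rule solvable_embedded[OF 1(4) 2(4) assms(3)]) (use 1 2 plainD assms in auto)
  then show ?thesis
    using provableI[of t "s + x" "{#}" \<Delta>' i'] 1 2 p by simp
qed

lemma goal_test: "set_mset V \<subseteq> {1..N - 7} \<Longrightarrow> p \<notin># V \<Longrightarrow> ({#SE V#}, 0) \<in> E_tests (add_mset p V)"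
  using provable_refl[of V] has_charge_total[of N "{#SE V#}"]
  by (auto simp: E_tests_def zero_prod_def)

lemma orth_sem_E_plain: "plain (mset X) \<Longrightarrow> orth (sem (E N (p # X))) = E_tests (add_mset p (mset X))"
  using orth_sem_E[of "p # X"] p plainD(2)[of "mset X"] by simp

lemma orth_sem_E_p: "orth (sem (E N [p])) = E_tests {#p#}"
  using orth_sem_E[of "[p]"] p by simp

lemma horn_step:
  assumes "A \<in> uses (HORN X Y) Output" "\<And>\<Delta>. consumes \<Gamma> (D + \<Delta>) A \<Delta>" "plain X" "plain Y"
    and "w \<in> E_tests (add_mset p Y)"
  shows "w + resource {#} D i \<in> E_tests (add_mset p X)"
proof (rule E_tests_step[OF assms(5,5)])
  fix t x \<Delta> j assume "provable t (x + add_mset p Y, \<Delta>, j)"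
  then show "provable t (x + {#} + add_mset p X, D + \<Delta>, i + j)"
    using provable_horn[OF _ assms(1,2,3,4)] by simp
qed

lemma F_horn_mem:
  assumes "A \<in> uses (HORN (mset X) (mset Y)) Output" "\<And>\<Delta>. consumes \<Gamma> (D + \<Delta>) A \<Delta>"
    "plain (mset X)" "plain (mset Y)"
  shows "resource {#} D i \<in> sem (F_horn N p X Y)"
  unfolding F_horn_def mem_sem_limp' orth_sem_E_plain[OF assms(3)] orth_sem_E_plain[OF assms(4)]
  using horn_step[OF assms] by blast

text \<open>A formula of \<open>K\<close> only adds its product to the input; no edge of the program
  corresponds to it.\<close>

lemma F_prod_mem:
  assumes "plain (mset T)" shows "resource (mset T) {#} 0 \<in> sem (F_prod N p T)"
  unfolding F_prod_def mem_sem_limp' orth_sem_E_plain[OF assms] orth_sem_E_p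
proof
  fix w assume w: "w \<in> E_tests (add_mset p (mset T))"
  show "w + resource (mset T) {#} 0 \<in> E_tests {#p#}"
    by (rule E_tests_step[OF w w]) (simp add: ac_simps)
qed

text \<open>Charges force \<open>s\<close> to have an empty sector, so it is a mere resource,
  possibly with elements of \<open>H1\<close>; these are excluded when the total count is
  \<open>0\<close>. Testing \<open>s\<close> against the generic test for \<open>V\<close> yields
  the inner computation, \<open>w\<close> yields the outer one, and a push with its pop joins
  them.\<close>

lemma F_embedded_mem:
  assumes "\<And>\<Delta>. consumes \<Gamma> (D + \<Delta>) (Embedded (mset U) (mset V) (mset Y)) \<Delta>"
    "plain (mset U)" "plain (mset V)" "plain (mset Y)"
  shows "resource {#} D i \<in> sem (F_horn N p U V \<multimap> F_prod N p Y)"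
  unfolding mem_sem_limp[of _ "F_horn N p U V"] F_prod_def
  unfolding mem_sem_limp' orth_sem_E_plain[OF assms(4)] orth_sem_E_p
proof (intro ballI)
  fix s w assume s: "s \<in> sem (F_horn N p U V)" and w: "w \<in> E_tests (add_mset p (mset Y))"
  \<comment> \<open>The goal is set to \<open>V\<close>: this converts membership of
    \<open>s\<close> into the existence of a program that computes \<open>V\<close>.\<close>
  define e where "e = ({#SE (mset V)#}, 0 :: resource)"
  have e: "e \<in> E_tests (add_mset p (mset V))"
    unfolding e_def using assms(3) by (intro goal_test plainD)
  then have es: "e + s \<in> E_tests (add_mset p (mset U))"
    using s unfolding F_horn_def mem_sem_limp' orth_sem_E_plain[OF assms(2)] orth_sem_E_plain[OF assms(3)]
    by blast
  have "has_charge N (3 * int N + 1) (fst s + fst e)"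
    using E_tests_charge[OF es] by (simp add: add.commute)
  from has_charge_cancel[OF this E_tests_charge[OF e]] have cs: "has_charge N 0 (fst s)" by simp
  have "provable t (x + {#p#}, \<Delta>, k)" if eq: "w + (s + resource {#} D i) = ({#SE t#}, 0, x, \<Delta>, k)" for t x \<Delta> k
  proof -
    have sum: "fst w + fst s = {#SE t#}" using arg_cong[OF eq, of fst] by (simp add: resource_def)
    then have "fst s \<subseteq># {#SE t#}" by (metis mset_subset_eq_add_right)
    then have "fst s = {#} \<or> fst s = {#SE t#}" by (auto simp: subseteq_add_mset_iff)
    then have fs: "fst s = {#}"
      using has_charge_small[OF cs] N8 by (elim disjE) auto
    then have fw: "fst w = {#SE t#}" using sum by simp
    obtain n1 x1 \<Delta>1 i1 where s': "s = ({#}, n1, x1, \<Delta>1, i1)" using fs by (metis prod.collapse)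
    obtain n2 x2 \<Delta>2 i2 where w': "w = ({#SE t#}, n2, x2, \<Delta>2, i2)" using fw by (metis prod.collapse)
    have n: "n1 = 0" "n2 = 0" and x: "x = x1 + x2" and \<Delta>: "\<Delta> = D + (\<Delta>1 + \<Delta>2)"
      using eq by (auto simp: s' w' resource_def ac_simps)
    have "provable (mset V) (x1 + add_mset p (mset U), \<Delta>1, i1)"
      using es by (simp add: E_tests_def e_def s' n zero_prod_def)
    moreover have "provable t (x2 + add_mset p (mset Y), \<Delta>2, i2)"
      using w by (simp add: E_tests_def w' n)
    ultimately show ?thesis
      unfolding x \<Delta> using provable_embedded[OF _ _ assms(1) assms(2-4)] by blast
  qed
  moreover have "has_charge N (3 * int N + 1 + 0) (fst w + fst s)"
    using E_tests_charge[OF w] cs by (intro has_charge_add)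
  ultimately show "w + (s + resource {#} D i) \<in> E_tests {#p#}"
    by (simp add: E_tests_def resource_def)
qed

lemma normalized_plain: "normalized_without N p A \<Longrightarrow> X \<in> products A \<Longrightarrow> plain (mset X)"
  by (auto simp: normalized_without_def plain_def)

text \<open>A singleton \<open>D\<close> is used for formulas of the linear context, an empty
  \<open>D\<close> for those under a bang. The number \<open>i\<close> of marks is arbitrary since
  the goals concerned are nonempty and ignore it.\<close>

lemma F_mem:
  assumes "\<And>\<Delta>. consumes \<Gamma> (D + \<Delta>) (map_nform mset A) \<Delta>" "normalized_without N p A"
  shows "resource {#} D i \<in> sem (F N p A)"
proof (cases A)
  case (Horn X Y)
  then show ?thesis
    using assms F_horn_mem[of "map_nform mset A" X Y D i] normalized_plain[OF assms(2)] by simp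
next
  case (PlusHorn X Y1 Y2)
  then have pl: "plain (mset X)" "plain (mset Y1)" "plain (mset Y2)"
    using normalized_plain[OF assms(2)] by simp_all
  have eq: "orth (sem (E N (p # Y1) \<oplus> E N (p # Y2))) = E_tests (add_mset p (mset Y1)) \<inter> E_tests (add_mset p (mset Y2))"
    using pl by (simp add: orth_sem_E_plain[symmetric] flip: orth_Un)
  have "w + resource {#} D i \<in> E_tests (add_mset p (mset X))"
    if w: "w \<in> E_tests (add_mset p (mset Y1)) \<inter> E_tests (add_mset p (mset Y2))" for w
  proof (rule E_tests_step[of _ "add_mset p (mset Y1)" "add_mset p (mset Y2)"])
    fix t x \<Delta> j assume "provable t (x + add_mset p (mset Y1), \<Delta>, j)" "provable t (x + add_mset p (mset Y2), \<Delta>, j)"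
    then show "provable t (x + {#} + add_mset p (mset X), D + \<Delta>, i + j)"
      using provable_plus[OF _ _ assms(1)[unfolded PlusHorn, simplified] pl] by simp
  qed (use w in auto)
  then show ?thesis
    unfolding PlusHorn F.simps mem_sem_limp' eq orth_sem_E_plain[OF pl(1)] by blast
next
  case (WithHorn X1 Y1 X2 Y2)
  then show ?thesis
    using assms F_horn_mem[of "map_nform mset A" X1 Y1 D i] F_horn_mem[of "map_nform mset A" X2 Y2 D i]
      normalized_plain[OF assms(2)] by simp
next
  case (Embedded U V Y)
  then show ?thesis
    using assms(1) F_embedded_mem[of D U V Y i] normalized_plain[OF assms(2)]
    by (simp del: sem.simps)
qed

lemma E_point_mem: "set X \<subseteq> {1..N - 7} \<Longrightarrow> (replicate_mset 6 SC, lits (mset X)) \<in> sem (E N X)"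
  using E_point_gens[of X] orth_orth_extensive[of "E_gens X"] by (auto simp: sem_E)

section \<open>From an encoded sequent to a program\<close>

definition context_of ::
  "nat list \<Rightarrow> nat list multiset \<Rightarrow> nat list nform multiset \<Rightarrow> nat list nform multiset \<Rightarrow> ll multiset" where
  "context_of W K \<Delta> G = {#E N W#} + image_mset (F_prod N p) K + image_mset (F N p) \<Delta>
     + image_mset (\<lambda>A. OfCourse (F N p A)) G"

lemma F_bang_mem:
  assumes "A \<in># G" "image_mset (map_nform mset) G = \<Gamma>" "normalized_without N p A"
  shows "resource {#} {#} i \<in> sem (F N p A)"
proof (rule F_mem)
  show "consumes \<Gamma> ({#} + \<Delta>) (map_nform mset A) \<Delta>" for \<Delta>
    using assms(1,2) by (auto simp: consumes_def)
qed (fact assms(3))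

lemma resource_zero: "resource {#} {#} 0 = 0"
  by (simp add: resource_def zero_prod_def)

text \<open>Each formula of the sequent is instantiated by its generic point, with \<open>0\<close>
  for those under a bang and \<open>SE\<close> for the conclusion. The sum lies in the goal sector,
  where admissibility is provability. The case \<open>i = 0\<close> serves plain soundness,
  \<open>i = 1\<close> a derivation with a dereliction.\<close>

lemma provable_of_seq:
  assumes "image_mset (map_nform mset) G = \<Gamma>"
    and G: "\<forall>A\<in>#G. normalized_without N p A" and \<Delta>: "\<forall>A\<in>#\<Delta>. normalized_without N p A"
    and K: "\<forall>T\<in>#K. plain (mset T)" and W: "set W \<subseteq> {1..N - 7}" and Z: "set Z \<subseteq> {1..N - 7}" "p \<notin> set Z"
    and seq: "resource {#} {#} i \<in> seq (context_of W K \<Delta> G) {#E N (p # Z)#}"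
  shows "provable (mset Z) (mset W + \<Sum>\<^sub># (image_mset mset K), image_mset (map_nform mset) \<Delta>, i)"
proof -
  define e where "e = (replicate_mset 6 SC, lits (mset W))"
  have K': "(\<Sum>T\<in>#K. resource (mset T) {#} 0) \<in> ante (image_mset (F_prod N p) K)"
    unfolding ante_image using K F_prod_mem by (intro sum_mset_mem) auto
  have \<Delta>': "(\<Sum>A\<in>#\<Delta>. resource {#} {#map_nform mset A#} 0) \<in> ante (image_mset (F N p) \<Delta>)"
    unfolding ante_image using \<Delta> by (intro sum_mset_mem F_mem) (auto simp: consumes_def)
  have "(\<Sum>A\<in>#G. resource {#} {#} 0) \<in> ante (image_mset (\<lambda>A. OfCourse (F N p A)) G)"
    unfolding ante_image
  proof (rule sum_mset_mem)
    fix A assume "A \<in># G"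
    then have "0 \<in> sem (F N p A)"
      using F_bang_mem[OF _ assms(1), of A 0] G by (simp add: resource_zero)
    then show "resource {#} {#} 0 \<in> sem (OfCourse (F N p A))"
      unfolding resource_zero by (rule zero_in_bang)
  qed
  then have G': "0 \<in> ante (image_mset (\<lambda>A. OfCourse (F N p A)) G)"
    by (simp add: resource_zero)
  have z: "({#SE (mset Z)#}, 0) \<in> succ {#E N (p # Z)#}"
    using orth_sem_E[of "p # Z"] p Z goal_test[of "mset Z"] by simp
  have "e + (\<Sum>T\<in>#K. resource (mset T) {#} 0) + (\<Sum>A\<in>#\<Delta>. resource {#} {#map_nform mset A#} 0) + 0
    \<in> ante (context_of W K \<Delta> G)"
    unfolding context_of_def ante_simps
    using E_point_mem[OF W] K' \<Delta>' G' by (intro set_plus_intro) (simp_all add: e_def)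
  moreover have "(\<Sum>T\<in>#K. resource (mset T) {#} 0) = resource (\<Sum>\<^sub># (image_mset mset K)) {#} 0"
    by (induction K) (simp_all add: resource_def zero_prod_def)
  moreover have "(\<Sum>A\<in>#\<Delta>. resource {#} {#map_nform mset A#} 0) = resource {#} (image_mset (map_nform mset) \<Delta>) 0"
    by (induction \<Delta>) (simp_all add: resource_def zero_prod_def)
  ultimately have a: "e + resource (\<Sum>\<^sub># (image_mset mset K)) {#} 0 + resource {#} (image_mset (map_nform mset) \<Delta>) 0
      \<in> ante (context_of W K \<Delta> G)"
    by simp
  have "e + resource (\<Sum>\<^sub># (image_mset mset K)) {#} 0 + resource {#} (image_mset (map_nform mset) \<Delta>) 0
      + ({#SE (mset Z)#}, 0) + resource {#} {#} i \<in> cpole"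
    using seq set_plus_intro[OF a z] unfolding seq_def orth_iff by blast
  then have "(add_mset (SE (mset Z)) (replicate_mset 6 SC),
      0, mset W + \<Sum>\<^sub># (image_mset mset K), image_mset (map_nform mset) \<Delta>, i) \<in> cpole"
    by (simp add: e_def resource_def lits_def zero_prod_def)
  from cpole_admissible[OF this] show ?thesis
    unfolding admissible_def by auto
qed

end

theorem theorem4p2:
  fixes N p :: nat
    and \<Gamma> \<Delta> :: "nat list nform multiset"
    and K :: "nat list multiset"
    and W' :: "nat list"
  assumes "p \<in> {1..N - 7}"
    and "\<forall>A \<in># \<Gamma>. normalized_without N p A"
    and "\<forall>A \<in># \<Delta>. normalized_without N p A"
    and "\<forall>T \<in># K. simple_product N (mset T) \<and> p \<notin> set T"
    and "simple_product N (mset W')"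
  shows
    "(\<forall>Z :: nat list.
        simple_product N (mset Z) \<and> p \<notin> set Z \<and>
        derivable
          ({#E N W'#} + image_mset (F_prod N p) K + image_mset (F N p) \<Delta>
             + image_mset (\<lambda>A. OfCourse (F N p A)) \<Gamma>)
          {#E N (p # Z)#}
        \<longrightarrow> count (mset W') p = 1 \<and>
            (\<exists>W. mset W' = add_mset p W \<and>
              (\<exists>P. strong_solution N P
                     (add_mset W (image_mset mset K))
                     (image_mset (map_nform mset) \<Delta>)
                     (image_mset (map_nform mset) \<Gamma>)
                     (mset Z))))
     \<and>
     (derivable
        ({#E N W'#} + image_mset (F_prod N p) K + image_mset (F N p) \<Delta>
           + image_mset (\<lambda>A. OfCourse (F N p A)) \<Gamma>)
        {#E N [p]#}
        \<longrightarrow> W' = [p] \<and> K = {#} \<and> \<Delta> = {#} \<and>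
            (\<forall>k. LL k
                   ({#E N W'#} + image_mset (F_prod N p) K + image_mset (F N p) \<Delta>
                      + image_mset (\<lambda>A. OfCourse (F N p A)) \<Gamma>)
                   {#E N [p]#}
               \<longrightarrow> k = 0))"
proof -
  define G where "G = image_mset (map_nform mset) \<Gamma>"
  interpret literal_encoding N p G
    using assms(1) by unfold_locales auto
  have K: "\<forall>T\<in>#K. plain (mset T)"
    using assms(4) by (auto simp: plain_def)
  have W': "set W' \<subseteq> {1..N - 7}" "W' \<noteq> []"
    using assms(5) by (auto simp: simple_product_def)
  note key = provable_of_seq[OF G_def[symmetric] assms(2,3) K W'(1), unfolded context_of_def]
  have derivable: "provable (mset Z) (mset W' + \<Sum>\<^sub># (image_mset mset K), image_mset (map_nform mset) \<Delta>, 0)"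
    if "derivable ({#E N W'#} + image_mset (F_prod N p) K + image_mset (F N p) \<Delta>
          + image_mset (\<lambda>A. OfCourse (F N p A)) \<Gamma>) {#E N (p # Z)#}"
      and "set Z \<subseteq> {1..N - 7}" "p \<notin> set Z" for Z
    using that by (intro key) (auto simp: resource_zero derivable_def intro: soundness)
  have "p \<notin># \<Sum>\<^sub># (image_mset mset K)"
    using assms(4) by auto
  then have pK: "count (\<Sum>\<^sub># (image_mset mset K)) p = 0"
    by (simp only: not_in_iff)
  show ?thesis
  proof (intro conjI allI impI; (elim conjE)?)
    fix Z assume Z: "simple_product N (mset Z)" "p \<notin> set Z"
      and der: "derivable ({#E N W'#} + image_mset (F_prod N p) K + image_mset (F N p) \<Delta>
          + image_mset (\<lambda>A. OfCourse (F N p A)) \<Gamma>) {#E N (p # Z)#}"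
    have "mset Z \<noteq> {#}" "set Z \<subseteq> {1..N - 7}" using Z(1) by (auto simp: simple_product_def)
    then have pr: "count (mset W' + \<Sum>\<^sub># (image_mset mset K)) p = 1"
      "solvable N G (mset W' + \<Sum>\<^sub># (image_mset mset K) - {#p#}) (image_mset (map_nform mset) \<Delta>) (mset Z)"
      using derivable[OF der _ Z(2)] by (simp_all add: provable_def)
    then show c: "count (mset W') p = 1" using pK by simp
    then have "p \<in># mset W'" by (metis count_eq_zero_iff zero_neq_one)
    then obtain W where W: "mset W' = add_mset p W" by (metis mset_add)
    obtain P where "strong_solution N P {#W + \<Sum>\<^sub># (image_mset mset K)#} (image_mset (map_nform mset) \<Delta>) G (mset Z)"
      using pr(2) by (auto simp: solvable_def W)
    then have "strong_solution N P (add_mset W (image_mset mset K)) (image_mset (map_nform mset) \<Delta>)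
        (image_mset (map_nform mset) \<Gamma>) (mset Z)"
      by (simp add: strong_solution_def G_def)
    then show "\<exists>W. mset W' = add_mset p W \<and> (\<exists>P. strong_solution N P (add_mset W (image_mset mset K))
        (image_mset (map_nform mset) \<Delta>) (image_mset (map_nform mset) \<Gamma>) (mset Z))"
      using W by blast
  next
    assume der: "derivable ({#E N W'#} + image_mset (F_prod N p) K + image_mset (F N p) \<Delta>
          + image_mset (\<lambda>A. OfCourse (F N p A)) \<Gamma>) {#E N [p]#}"
    \<comment> \<open>\<open>Z = []\<close> gives the conclusion of part (b) and selects the branch
      of the empty goal in \<open>provable\<close>.\<close>
    then have eq: "mset W' + \<Sum>\<^sub># (image_mset mset K) = {#p#}" and \<Delta>: "\<Delta> = {#}"
      using derivable[of "[]"] by (auto simp: provable_def)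
    have "mset W' = {#p#}" "\<Sum>\<^sub># (image_mset mset K) = {#}"
      using eq W'(2) by (auto simp: union_is_single)
    then show W'p: "W' = [p]" and K0: "K = {#}"
      using K plainD(1) by (simp, fastforce intro: multiset_eqI simp: not_in_iff)
    show "\<Delta> = {#}" by (fact \<Delta>)
    fix k assume k: "LL k ({#E N W'#} + image_mset (F_prod N p) K + image_mset (F N p) \<Delta>
          + image_mset (\<lambda>A. OfCourse (F N p A)) \<Gamma>) {#E N [p]#}"
    show "k = 0"
    proof (rule ccontr)
      assume "k \<noteq> 0"
      have "marked (resource {#} {#} 1) (E N [p])" "multiplicative (E N [p])"
        using multiplicative_E[of N "[p]"] N8 by simp_all
      \<comment> \<open>The point with one mark lies in every \<open>F\<close> that stands under a
        bang, so it may serve as \<open>\<tau>\<close>.\<close>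
      moreover have "marked (resource {#} {#} 1) (OfCourse (F N p A))" if "A \<in># \<Gamma>" for A
        using F_bang_mem[OF that G_def[symmetric], of 1] assms(2) that by simp
      ultimately have "resource {#} {#} 1 \<in> seq ({#E N W'#} + image_mset (F_prod N p) K + image_mset (F N p) \<Delta>
          + image_mset (\<lambda>A. OfCourse (F N p A)) \<Gamma>) {#E N [p]#}"
        using \<open>k \<noteq> 0\<close> W'p K0 \<Delta> by (intro soundness_dereliction[OF k]) auto
      \<comment> \<open>The empty goal would have to be provable with one mark, but it demands that
        there be none.\<close>
      from key[of "[]", OF _ _ this] show False
        by (simp add: provable_def)
    qed
  qed
qed

end
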